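(* Let $\epsilon$ be a positive real. There is an algorithm that, for a given tree $T$ of order $n$ and a given function $w:V(T)\to \mathbb{Z}_{\geq 0}$, determines a connected $w$-safe set $S$ in $T$ with $w(S)\leq (1+\epsilon)\,cs(T,w)$ in time $O\left(\frac{1}{\epsilon^4}n^{O\left(\frac{1}{\epsilon}\right)}\right)$.
   Context: For a graph $G$, a weight function $w:V(G)\to\mathbb{Z}_{\geq 0}$, a set $U\subseteq V(G)$ and a subgraph $H$ of $G$, let $w(U)=\sum_{u\in U}w(u)$ and $w(H)=w(V(H))$. Two disjoint subgraphs $C,D$ of $G$ are adjacent if some vertex of $C$ is adjacent to some vertex of $D$. A set $S\subseteq V(G)$ is $w$-safe if $w(C)\geq w(D)$ for every component $C$ of the induced subgraph $G[S]$ and every component $D$ of $G-S$ (the subgraph induced by $V(G)\setminus S$) such that $D$ is adjacent to $C$. A set $S$ is connected if $G[S]$ is connected. The connected safe number $cs(G,w)$ is the minimum of $w(S)$ over all connected $w$-safe sets $S$ in $G$. *)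

theory Defs
  imports Complex_Main "Graph_Theory.Graph_Theory"
begin

text \<open>
  Undirected finite simple graphs are \<^locale>\<open>pair_graph\<close>s: each edge \<open>uv\<close> is present as the
  two arcs \<open>(u, v)\<close> and \<open>(v, u)\<close>. On symmetric digraphs the components are the strongly connected
  components.
\<close>

definition weight :: "('a \<Rightarrow> nat) \<Rightarrow> 'a set \<Rightarrow> nat" where
  "weight w U = (\<Sum>u\<in>U. w u)"

definition components :: "('a, 'b) pre_digraph \<Rightarrow> ('a, 'b) pre_digraph set" where
  "components G = pre_digraph.sccs G"

definition adjacent_in ::
  "('a, 'b) pre_digraph \<Rightarrow> ('a, 'b) pre_digraph \<Rightarrow> ('a, 'b) pre_digraph \<Rightarrow> bool" where
  "adjacent_in G C D \<longleftrightarrow> (\<exists>u\<in>verts C. \<exists>v\<in>verts D. u \<rightarrow>\<^bsub>G\<^esub> v)"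

definition safe_set :: "('a, 'b) pre_digraph \<Rightarrow> ('a \<Rightarrow> nat) \<Rightarrow> 'a set \<Rightarrow> bool" where
  "safe_set G w S \<longleftrightarrow> S \<subseteq> verts G \<and>
     (\<forall>C\<in>components (G \<restriction> S). \<forall>D\<in>components (G \<restriction> (verts G - S)).
        adjacent_in G C D \<longrightarrow> weight w (verts C) \<ge> weight w (verts D))"

text \<open>
  The library's \<^const>\<open>Digraph_Component.connected\<close> requires a nonempty vertex set; in particular
  the empty set, which is vacuously safe, is not a connected safe set.
\<close>

definition connected_safe_set :: "('a, 'b) pre_digraph \<Rightarrow> ('a \<Rightarrow> nat) \<Rightarrow> 'a set \<Rightarrow> bool" where
  "connected_safe_set G w S \<longleftrightarrow> safe_set G w S \<and> Digraph_Component.connected (G \<restriction> S)"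

definition connected_safe_number :: "('a, 'b) pre_digraph \<Rightarrow> ('a \<Rightarrow> nat) \<Rightarrow> nat" where
  "connected_safe_number G w = Min {weight w S |S. connected_safe_set G w S}"

text \<open>
  The library's \<^const>\<open>Digraph_Component.tree\<close> cannot be used for undirected trees: in a symmetric
  digraph the two arcs of any edge form a (directed) cycle of length 2. The cycles of the
  undirected graph are the directed cycles of length at least 3.
\<close>

definition undirected_tree :: "'a pair_pre_digraph \<Rightarrow> bool" where
  "undirected_tree T \<longleftrightarrow> pair_graph T \<and> Digraph_Component.connected (with_proj T) \<and>
     \<not> (\<exists>p. pre_digraph.cycle (with_proj T) p \<and> 3 \<le> length p)"


text \<open>
  The model of computation is the random access machine under the uniform cost criterion, with
  structured control flow. The memory consists of arrays \<open>0, 1, 2, \<dots>\<close> of unbounded length whose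
  cells hold natural numbers; the arrays a program uses are named in its text, the index into an
  array is computed. The only arithmetic is addition and truncated subtraction; there is no
  unit-cost multiplication or division.
\<close>

type_synonym memory = "nat \<Rightarrow> nat \<Rightarrow> nat"

datatype aexp = Num nat | Cell nat aexp | Add aexp aexp | Sub aexp aexp

datatype bexp = Less aexp aexp | Neg bexp | Conj bexp bexp

datatype com =
    Skip
  | Assign nat aexp aexp
  | Seq com com
  | Cond bexp com com
  | Loop bexp com

primrec aval :: "aexp \<Rightarrow> memory \<Rightarrow> nat" where
  "aval (Num k) M = k"
| "aval (Cell a i) M = M a (aval i M)"
| "aval (Add x y) M = aval x M + aval y M"
| "aval (Sub x y) M = aval x M - aval y M"

primrec atime :: "aexp \<Rightarrow> nat" where
  "atime (Num k) = 1"
| "atime (Cell a i) = 1 + atime i"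
| "atime (Add x y) = 1 + atime x + atime y"
| "atime (Sub x y) = 1 + atime x + atime y"

primrec bval :: "bexp \<Rightarrow> memory \<Rightarrow> bool" where
  "bval (Less x y) M \<longleftrightarrow> aval x M < aval y M"
| "bval (Neg b) M \<longleftrightarrow> \<not> bval b M"
| "bval (Conj b c) M \<longleftrightarrow> bval b M \<and> bval c M"

primrec btime :: "bexp \<Rightarrow> nat" where
  "btime (Less x y) = 1 + atime x + atime y"
| "btime (Neg b) = 1 + btime b"
| "btime (Conj b c) = 1 + btime b + btime c"

text \<open>\<open>exec c M t M'\<close>: started in memory \<open>M\<close>, program \<open>c\<close> halts after \<open>t\<close> steps in memory \<open>M'\<close>.\<close>

inductive exec :: "com \<Rightarrow> memory \<Rightarrow> nat \<Rightarrow> memory \<Rightarrow> bool" where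
  exec_Skip: "exec Skip M 1 M"
| exec_Assign:
    "exec (Assign a i x) M (1 + atime i + atime x) (M(a := (M a)(aval i M := aval x M)))"
| exec_Seq: "exec c M s M' \<Longrightarrow> exec d M' t M'' \<Longrightarrow> exec (Seq c d) M (s + t) M''"
| exec_CondT: "bval b M \<Longrightarrow> exec c M t M' \<Longrightarrow> exec (Cond b c d) M (1 + btime b + t) M'"
| exec_CondF: "\<not> bval b M \<Longrightarrow> exec d M t M' \<Longrightarrow> exec (Cond b c d) M (1 + btime b + t) M'"
| exec_LoopF: "\<not> bval b M \<Longrightarrow> exec (Loop b c) M (1 + btime b) M"
| exec_LoopT: "bval b M \<Longrightarrow> exec c M s M' \<Longrightarrow> exec (Loop b c) M' t M'' \<Longrightarrow>
    exec (Loop b c) M (1 + btime b + s + t) M''"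

inductive_cases exec_SkipE: "exec Skip M t M'"
inductive_cases exec_AssignE: "exec (Assign a i x) M t M'"
inductive_cases exec_SeqE: "exec (Seq c d) M t M'"
inductive_cases exec_CondE: "exec (Cond b c d) M t M'"
inductive_cases exec_LoopE: "exec (Loop b c) M t M'"

lemma exec_deterministic:
  "exec c M t M' \<Longrightarrow> exec c M u N \<Longrightarrow> u = t \<and> N = M'"
proof (induction arbitrary: u N rule: exec.induct)
  case exec_Skip then show ?case by (auto elim: exec_SkipE)
next
  case exec_Assign then show ?case by (auto elim: exec_AssignE)
next
  case (exec_Seq c M s M' d t M'')
  from exec_Seq.prems obtain s1 M1 t1 where 1: "u = s1 + t1" "exec c M s1 M1" "exec d M1 t1 N"
    by (rule exec_SeqE)
  from exec_Seq.IH(1)[OF 1(2)] have 2: "s1 = s" "M1 = M'" by blast+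
  from exec_Seq.IH(2)[OF 1(3)[unfolded 2]] 1(1) 2(1) show ?case by blast
next
  case (exec_CondT b M c t M' d)
  from exec_CondT.prems show ?case
    by (rule exec_CondE) (use exec_CondT.hyps in \<open>auto dest: exec_CondT.IH\<close>)
next
  case (exec_CondF b M d t M' c)
  from exec_CondF.prems show ?case
    by (rule exec_CondE) (use exec_CondF.hyps in \<open>auto dest: exec_CondF.IH\<close>)
next
  case (exec_LoopF b M c)
  from exec_LoopF.prems show ?case
    by (rule exec_LoopE) (use exec_LoopF.hyps in simp_all)
next
  case (exec_LoopT b M c s M' t M'')
  from exec_LoopT.prems exec_LoopT.hyps(1) obtain s1 M1 t1
    where 1: "u = 1 + btime b + s1 + t1" "exec c M s1 M1" "exec (Loop b c) M1 t1 N"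
    by (auto elim: exec_LoopE)
  from exec_LoopT.IH(1)[OF 1(2)] have 2: "s1 = s" "M1 = M'" by blast+
  from exec_LoopT.IH(2)[OF 1(3)[unfolded 2]] 1(1) 2(1) show ?case by blast
qed


text \<open>
  A graph on the vertices \<open>0, \<dots>, n - 1\<close> is given to a program by \<open>n\<close> and a list of its edges,
  each edge once, in any order and orientation.
\<close>

definition edge_list :: "'a pair_pre_digraph \<Rightarrow> ('a \<times> 'a) list \<Rightarrow> bool" where
  "edge_list G es \<longleftrightarrow> distinct es \<and> set es \<inter> (set es)\<inverse> = {} \<and> set es \<union> (set es)\<inverse> = parcs G"

definition input_memory :: "nat \<Rightarrow> (nat \<times> nat) list \<Rightarrow> (nat \<Rightarrow> nat) \<Rightarrow> memory" where
  "input_memory n es w = (\<lambda>_ _. 0)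
     (0 := (\<lambda>_. 0)(0 := n, 1 := length es),
      1 := (\<lambda>v. if v < n then w v else 0),
      2 := (\<lambda>i. if i < length es then fst (es ! i) else 0),
      3 := (\<lambda>i. if i < length es then snd (es ! i) else 0))"

definition output_set :: "nat \<Rightarrow> memory \<Rightarrow> nat set" where
  "output_set n M = {v. v < n \<and> M 4 v \<noteq> 0}"

end

theory Submission
  imports Defs
begin

text \<open>
  Let \<open>U\<close> be a connected safe set of minimum weight \<open>W\<close>, rooted at one of its vertices. It contains
  every vertex whose subtree is heavier than the heaviest subtree that it misses, and that threshold
  \<open>\<mu>\<close> is at most \<open>W\<close>. Conversely every parent-closed set that contains the root and all vertices
  with subtrees heavier than \<open>\<mu>\<close> is safe as soon as its own weight reaches \<open>\<mu>\<close>. So it suffices to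
  guess the root, the threshold and the at most \<open>1 / \<epsilon>\<close> vertices of \<open>U\<close> of weight more than
  \<open>\<epsilon> W\<close>, together with a heaviest remaining vertex of \<open>U\<close>, to take the parent closure of the guess
  and of the forced vertices, and to add further vertices that are no heavier than that last guess,
  parents first, until the weight reaches \<open>\<mu>\<close>. Before the last addition the weight is below \<open>W\<close>,
  so the result weighs at most \<open>(1 + \<epsilon>) W\<close>.
\<close>

subsection \<open>Total correctness with time bounds\<close>

text \<open>Each component left over by a connected set through the root hangs below one missing
  vertex whose parent is in the set, so safety becomes a comparison with subtree weights. These
  depend on the root, which is why the root is guessed too. Both the threshold and the bound on
  light vertices are named by vertices, as a subtree weight and as a vertex weight. Hence every
  guess has only \<open>n\<close> values, and neither \<open>W\<close> nor \<open>\<epsilon>\<close>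
  occurs in the program, which has no multiplication. Only the tuple length \<open>k\<close> depends
  on \<open>\<epsilon>\<close>: one entry for the threshold, one for the heaviest light vertex, the
  others for the heavy ones.

  No guess is ever verified. A trial records its set only if the weight has reached the threshold,
  and this makes the set safe for any tuple. A right tuple matters for the weight bound alone. On
  such a tuple the additions cannot stop short of the threshold: proceeding parents first they would
  have absorbed all of \<open>U\<close>, which weighs at least \<open>\<mu>\<close>. With
  \<open>n\<close> roots, \<open>n ^ k\<close> tuples and a trial linear in \<open>n\<close> for
  fixed \<open>k\<close>, the exponent is \<open>k + 2\<close>.\<close>

definition runs :: "com \<Rightarrow> memory \<Rightarrow> nat \<Rightarrow> (memory \<Rightarrow> bool) \<Rightarrow> bool" where
  "runs c M b Q \<longleftrightarrow> (\<exists>t M'. exec c M t M' \<and> t \<le> b \<and> Q M')"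

primrec writes :: "com \<Rightarrow> nat set" where
  "writes Skip = {}"
| "writes (Assign a i x) = {a}"
| "writes (Seq c d) = writes c \<union> writes d"
| "writes (Cond b c d) = writes c \<union> writes d"
| "writes (Loop b c) = writes c"

abbreviation same_outside :: "nat set \<Rightarrow> memory \<Rightarrow> memory \<Rightarrow> bool" where
  "same_outside A M N \<equiv> \<forall>a. a \<notin> A \<longrightarrow> N a = M a"

lemma exec_writes: "exec c M t M' \<Longrightarrow> same_outside (writes c) M M'"
  by (induction rule: exec.induct) auto

text \<open>The frame is read off the program text, so postconditions need to mention only arrays
  that change. \<open>runs_weaken\<close>, \<open>runs_Seq\<close> and the body rule of
  \<open>runs_For\<close> supply it as an assumption.\<close>

lemma runs_frame:
  assumes "runs c M b Q"
  shows "runs c M b (\<lambda>M'. Q M' \<and> same_outside (writes c) M M')"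
  using assms exec_writes unfolding runs_def by blast

lemma runs_weaken:
  assumes "runs c M b Q" and "b \<le> b'" and "\<And>M'. Q M' \<Longrightarrow> same_outside (writes c) M M' \<Longrightarrow> Q' M'"
  shows "runs c M b' Q'"
  using runs_frame[OF assms(1)] assms(2,3) unfolding runs_def by (meson le_trans)

lemma runs_Seq:
  assumes "runs c M b Q"
    and "\<And>M'. Q M' \<Longrightarrow> same_outside (writes c) M M' \<Longrightarrow> runs d M' b' R"
    and "b + b' \<le> b''"
  shows "runs (Seq c d) M b'' R"
proof -
  from runs_frame[OF assms(1)] obtain t M' where 1: "exec c M t M'" "t \<le> b" "Q M'"
    "same_outside (writes c) M M'" unfolding runs_def by blast
  from assms(2)[OF 1(3,4)] obtain t' M'' where 2: "exec d M' t' M''" "t' \<le> b'" "R M''"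
    unfolding runs_def by blast
  have "t + t' \<le> b''" using 1 2 assms(3) by linarith
  then show ?thesis using exec_Seq[OF 1(1) 2(1)] 2(3) unfolding runs_def by blast
qed

lemma runs_Cond:
  assumes "bval p M \<Longrightarrow> runs c M b Q" and "\<not> bval p M \<Longrightarrow> runs d M b Q"
    and "1 + btime p + b \<le> b'"
  shows "runs (Cond p c d) M b' Q"
proof (cases "bval p M")
  case True
  then obtain t M' where 1: "exec c M t M'" "t \<le> b" "Q M'"
    using assms(1) unfolding runs_def by blast
  have "1 + btime p + t \<le> b'" using 1(2) assms(3) by linarith
  then show ?thesis using exec_CondT[OF True 1(1)] 1(3) unfolding runs_def by blast
next
  case False
  then obtain t M' where 1: "exec d M t M'" "t \<le> b" "Q M'"
    using assms(2) unfolding runs_def by blast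
  have "1 + btime p + t \<le> b'" using 1(2) assms(3) by linarith
  then show ?thesis using exec_CondF[OF False 1(1)] 1(3) unfolding runs_def by blast
qed

section \<open>Symbolic execution of loop-free programs, and counting loops\<close>

primrec loop_free :: "com \<Rightarrow> bool" where
  "loop_free Skip = True"
| "loop_free (Assign a i x) = True"
| "loop_free (Seq c d) = (loop_free c \<and> loop_free d)"
| "loop_free (Cond b c d) = (loop_free c \<and> loop_free d)"
| "loop_free (Loop b c) = False"

text \<open>The clause for \<open>Loop\<close> is a dummy value; the function is applied to
  loop-free programs, where \<open>simp\<close> evaluates it.\<close>

primrec result :: "com \<Rightarrow> memory \<Rightarrow> memory" where
  "result Skip M = M"
| "result (Assign a i x) M = M(a := (M a)(aval i M := aval x M))"
| "result (Seq c d) M = result d (result c M)"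
| "result (Cond b c d) M = (if bval b M then result c M else result d M)"
| "result (Loop b c) M = M"

text \<open>Both branches of a conditional are charged: an upper bound suffices, and the sum
  simplifies to a numeral.\<close>

primrec duration :: "com \<Rightarrow> nat" where
  "duration Skip = 1"
| "duration (Assign a i x) = 1 + atime i + atime x"
| "duration (Seq c d) = duration c + duration d"
| "duration (Cond b c d) = 1 + btime b + (duration c + duration d)"
| "duration (Loop b c) = 0"

lemma runs_loop_free:
  assumes "loop_free c"
  shows "runs c M (duration c) (\<lambda>M'. M' = result c M)"
  using assms
proof (induction c arbitrary: M)
  case Skip
  show ?case unfolding runs_def using exec_Skip by fastforce
next
  case (Assign a i x)
  show ?case unfolding runs_def using exec_Assign by fastforce
next
  case (Seq c d)
  then show ?case by (intro runs_Seq[where b = "duration c" and b' = "duration d" and Q = "\<lambda>M'. M' = result c M"]) auto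
next
  case (Cond p c d)
  then have *: "runs c M (duration c) (\<lambda>M'. M' = result c M)"
     "runs d M (duration d) (\<lambda>M'. M' = result d M)" by auto
  show ?case
    by (rule runs_Cond[where b = "duration c + duration d"])
      (auto intro: runs_weaken[OF *(1)] runs_weaken[OF *(2)])
qed auto

lemma runs_straight:
  assumes "loop_free c" and "Q (result c M)" and "duration c \<le> b"
  shows "runs c M b Q"
  by (rule runs_weaken[OF runs_loop_free[OF assms(1)] assms(3)]) (use assms(2) in simp)

definition For :: "nat \<Rightarrow> nat \<Rightarrow> aexp \<Rightarrow> com \<Rightarrow> com" where
  "For a j e c = Seq (Assign a (Num j) (Num 0))
    (Loop (Less (Cell a (Num j)) e)
      (Seq c (Assign a (Num j) (Add (Cell a (Num j)) (Num 1)))))"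

lemma writes_For [simp]: "writes (For a j e c) = insert a (writes c)"
  by (auto simp: For_def)

text \<open>Initialisation costs 3 and each test \<open>4 + atime e\<close>; the increment costs 6,
  hence the constants 7 and 10. Preservation of the counter is a postcondition of the body rather
  than part of its frame, because in \<open>nest\<close> the body itself writes to the array that
  contains the counter.\<close>

lemma runs_For:
  assumes init: "I 0 (M(a := (M a)(j := 0)))"
    and bound: "\<And>N. same_outside (insert a (writes c)) M N \<Longrightarrow> aval e N = B"
    and body: "\<And>i N. i < B \<Longrightarrow> I i N \<Longrightarrow> N a j = i \<Longrightarrow> same_outside (insert a (writes c)) M N \<Longrightarrow>
      runs c N tb (\<lambda>N'. N' a j = i \<and> I (Suc i) (N'(a := (N' a)(j := Suc i))))"
  shows "runs (For a j e c) M (7 + atime e + B * (tb + atime e + 10)) (I B)"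
proof -
  let ?inc = "Assign a (Num j) (Add (Cell a (Num j)) (Num 1))"
  let ?loop = "Loop (Less (Cell a (Num j)) e) (Seq c ?inc)"
  let ?W = "insert a (writes c)"
  have loop: "runs ?loop N (4 + atime e + (B - i) * (tb + atime e + 10)) (I B)"
    if "i \<le> B" "I i N" "N a j = i" "same_outside ?W M N" for i N
    using that
  proof (induction "B - i" arbitrary: i N)
    case 0
    then have "i = B" by simp
    have "\<not> bval (Less (Cell a (Num j)) e) N" using bound[OF 0(5)] 0(4) \<open>i = B\<close> by simp
    from exec_LoopF[OF this, of "Seq c ?inc"] show ?case unfolding runs_def
      by (rule_tac exI, rule_tac exI) (use 0 \<open>i = B\<close> in auto)
  next
    case (Suc d)
    then have "i < B" by simp
    have b: "bval (Less (Cell a (Num j)) e) N" using bound[OF Suc.prems(4)] Suc.prems(3) \<open>i < B\<close> by simp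
    from runs_frame[OF body[OF \<open>i < B\<close> Suc.prems(2-4)]] obtain t N' where
      1: "exec c N t N'" "t \<le> tb" "N' a j = i" "I (Suc i) (N'(a := (N' a)(j := Suc i)))"
        "same_outside (writes c) N N'" unfolding runs_def by blast
    let ?N = "N'(a := (N' a)(j := Suc i))"
    have inc: "exec ?inc N' 6 ?N"
      using exec_Assign[of a "Num j" "Add (Cell a (Num j)) (Num 1)" N'] 1(3)
      by (simp add: eval_nat_numeral)
    have fr: "same_outside ?W M ?N" using Suc.prems(4) 1(5) by simp
    have "runs ?loop ?N (4 + atime e + (B - Suc i) * (tb + atime e + 10)) (I B)"
      by (rule Suc.hyps(1)[of "Suc i" ?N]) (use Suc.hyps(2) \<open>i < B\<close> 1(4) fr in auto)
    then obtain t' N'' where 2: "exec ?loop ?N t' N''"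
      "t' \<le> 4 + atime e + (B - Suc i) * (tb + atime e + 10)" "I B N''" unfolding runs_def by blast
    have "B - i = Suc (B - Suc i)" using \<open>i < B\<close> by simp
    then have "1 + btime (Less (Cell a (Num j)) e) + (t + 6) + t'
        \<le> 4 + atime e + (B - i) * (tb + atime e + 10)"
      using 1(2) 2(2) by simp
    then show ?case using exec_LoopT[OF b exec_Seq[OF 1(1) inc] 2(1)] 2(3) unfolding runs_def by blast
  qed
  show ?thesis unfolding For_def
  proof (rule runs_Seq)
    show "runs (Assign a (Num j) (Num 0)) M 3 (\<lambda>M'. M' = M(a := (M a)(j := 0)))"
      by (rule runs_straight) auto
    fix M' :: memory assume "M' = M(a := (M a)(j := 0))"
    then show "runs ?loop M' (4 + atime e + (B - 0) * (tb + atime e + 10)) (I B)"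
      by (intro loop) (use init in auto)
  qed simp
qed

subsection \<open>Rooted trees and safe sets\<close>

lemma arcs_ends_induced: "arcs_ends (with_proj T \<restriction> A) = {(u, v) \<in> parcs T. u \<in> A \<and> v \<in> A}"
  by (auto simp: arcs_ends_def arc_to_ends_def)

lemma reachable_induced_refl: "u \<in> A \<Longrightarrow> u \<rightarrow>\<^sup>*\<^bsub>with_proj T \<restriction> A\<^esub> u"
  by (auto simp: reachable_def intro: rtrancl_on.intros)

lemma reachable_induced_step:
  assumes "u \<rightarrow>\<^sup>*\<^bsub>with_proj T \<restriction> A\<^esub> v" and "(v, x) \<in> parcs T" and "x \<in> A"
  shows "u \<rightarrow>\<^sup>*\<^bsub>with_proj T \<restriction> A\<^esub> x"
proof -
  have "v \<in> A" using assms(1) by (auto simp: reachable_def elim: rtrancl_on.cases)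
  then show ?thesis using assms unfolding reachable_def arcs_ends_induced
    by (auto intro: rtrancl_on_into_rtrancl_on)
qed

lemma reachable_induced_induct [consumes 1, case_names base step]:
  assumes "u \<rightarrow>\<^sup>*\<^bsub>with_proj T \<restriction> A\<^esub> v"
    and "u \<in> A \<Longrightarrow> P u"
    and "\<And>x y. P x \<Longrightarrow> (x, y) \<in> parcs T \<Longrightarrow> x \<in> A \<Longrightarrow> y \<in> A \<Longrightarrow> P y"
  shows "P v"
  using assms(1) unfolding reachable_def
  by (induct rule: rtrancl_on_induct) (use assms(2,3) in \<open>auto simp: arcs_ends_induced\<close>)

context pair_graph begin

lemma sym_digraph_induced:
  assumes "A \<subseteq> pverts G"
  shows "sym_digraph (with_proj G \<restriction> A)"
  using induced_graph_imp_graph induced_induce assms by simp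

text \<open>The arc relation is symmetric and so equals its symmetric closure; directed reachability
  therefore decides connectedness.\<close>

lemma connected_induced_iff:
  assumes "A \<subseteq> pverts G"
  shows "Digraph_Component.connected (with_proj G \<restriction> A) \<longleftrightarrow>
    A \<noteq> {} \<and> (\<forall>u\<in>A. \<forall>v\<in>A. u \<rightarrow>\<^sup>*\<^bsub>with_proj G \<restriction> A\<^esub> v)"
proof -
  interpret H: sym_digraph "with_proj G \<restriction> A" by (rule sym_digraph_induced[OF assms])
  have "(arcs_ends (with_proj G \<restriction> A))\<^sup>s = arcs_ends (with_proj G \<restriction> A)"
    using H.sym_arcs by (auto simp: symcl_def symmetric_def sym_def)
  then show ?thesis
    by (simp add: connected_conv reachable_def)
qed

lemma component_induced_verts:
  assumes "A \<subseteq> pverts G" and "C \<in> components (with_proj G \<restriction> A)"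
  shows "verts C \<noteq> {}" "verts C \<subseteq> A"
    and "u \<in> verts C \<Longrightarrow> verts C = {v. u \<rightarrow>\<^sup>*\<^bsub>with_proj G \<restriction> A\<^esub> v}"
proof -
  interpret H: sym_digraph "with_proj G \<restriction> A" by (rule sym_digraph_induced[OF assms(1)])
  have C: "verts C \<in> H.sccs_verts"
    using assms(2) H.sccs_verts_conv by (auto simp: components_def)
  then show "verts C \<noteq> {}" by (simp add: H.in_sccs_verts_conv_reachable)
  show "verts C \<subseteq> A" using H.sccs_verts_subsets[OF C] by simp
  show "verts C = {v. u \<rightarrow>\<^sup>*\<^bsub>with_proj G \<restriction> A\<^esub> v}" if "u \<in> verts C"
    using C that H.symmetric_reachable' unfolding H.in_sccs_verts_conv_reachable by blast
qed

lemma component_of_vertex: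
  assumes "A \<subseteq> pverts G" and "u \<in> A"
  obtains C where "C \<in> components (with_proj G \<restriction> A)"
    "verts C = {v. u \<rightarrow>\<^sup>*\<^bsub>with_proj G \<restriction> A\<^esub> v}"
proof -
  interpret H: sym_digraph "with_proj G \<restriction> A" by (rule sym_digraph_induced[OF assms(1)])
  show thesis
    using H.induce_reachable_is_in_sccs[of u] assms(2)
    by (intro that[of "(with_proj G \<restriction> A) \<restriction> {v. u \<rightarrow>\<^sup>*\<^bsub>with_proj G \<restriction> A\<^esub> v}"])
      (auto simp: components_def)
qed

text \<open>A simple path from \<open>u\<close> to \<open>v\<close> inside \<open>A\<close> closes
  up through the outside vertex \<open>x\<close>. It has an arc because \<open>u \<noteq> v\<close>,
  so the cycle has length at least 3, which is what \<open>undirected_tree\<close> forbids.\<close>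

lemma cycle_through_vertex:
  assumes "A \<subseteq> pverts G" and "x \<notin> A" and "u \<noteq> v" and "u \<rightarrow>\<^sup>*\<^bsub>with_proj G \<restriction> A\<^esub> v"
    and "(x, u) \<in> parcs G" and "(v, x) \<in> parcs G"
  shows "\<exists>p. cycle p \<and> 3 \<le> length p"
proof -
  interpret H: sym_digraph "with_proj G \<restriction> A" by (rule sym_digraph_induced[OF assms(1)])
  obtain p where p: "H.apath u p v"
    using assms(4) H.reachable_apath by blast
  have verts_eq: "H.awalk_verts = pawalk_verts"
    using compatible_awalk_verts[OF compatible_induce_subgraph[of "with_proj G" A]] by simp
  have "H.awalk u p v" using p by (simp add: H.apath_def)
  then have in_A: "set (pawalk_verts u p) \<subseteq> A"
    using H.awalk_conv[THEN iffD1] by (simp add: verts_eq)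
  have "awalk u p v"
    using \<open>H.awalk u p v\<close> induced_imp_subgraph[OF induced_induce[OF assms(1)]]
      subgraph_awalk_imp_awalk by blast
  moreover have d: "distinct (pawalk_verts u p)" using p by (simp add: H.apath_def verts_eq)
  moreover have "p \<noteq> []" using p assms(3) by (auto simp: H.apath_def H.awalk_Nil_iff)
  ultimately have "awalk x ((x, u) # p @ [(v, x)]) x"
    using assms(5,6) by (auto simp: awalk_simps wellformed')
  moreover have "tl (pawalk_verts x ((x, u) # p @ [(v, x)])) = pawalk_verts u p @ [x]"
    using \<open>awalk u p v\<close>
    by (induction p arbitrary: u) (auto simp: awalk_simps)
  ultimately show ?thesis
    using d in_A assms(2) \<open>p \<noteq> []\<close> unfolding cycle_def
    by (intro exI[of _ "(x, u) # p @ [(v, x)]"]) (auto simp: Suc_le_eq)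
qed

end

text \<open>\<open>od i\<close> is the vertex at position \<open>i\<close> of a search order,
  \<open>q i\<close> the position of its parent. Since parents have smaller positions, induction on
  positions replaces induction on the tree, and a single pass over an array meets parents before
  children or, backwards, children before parents.\<close>

locale rooted_tree =
  fixes T :: "nat pair_pre_digraph" and n :: nat and od q w :: "nat \<Rightarrow> nat"
  assumes tree: "undirected_tree T" and verts: "pverts T = {..<n}"
    and od_bij: "bij_betw od {..<n} {..<n}"
    and q_less: "\<And>i. 0 < i \<Longrightarrow> i < n \<Longrightarrow> q i < i"
    and q_arc: "\<And>i. 0 < i \<Longrightarrow> i < n \<Longrightarrow> (od i, od (q i)) \<in> parcs T"
begin

sublocale pair_graph T using tree by (simp add: undirected_tree_def)

lemma arc_sym: "(u, v) \<in> parcs T \<Longrightarrow> (v, u) \<in> parcs T"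
  using graph_symmetric by simp

lemma n_pos: "0 < n"
  using tree verts by (auto simp: undirected_tree_def connected_conv)

lemma od_less: "i < n \<Longrightarrow> od i < n"
  using od_bij by (auto simp: bij_betw_def)

lemma od_inj: "i < n \<Longrightarrow> j < n \<Longrightarrow> od i = od j \<longleftrightarrow> i = j"
  using od_bij by (auto simp: bij_betw_def inj_on_def)

lemma od_surj: "v < n \<Longrightarrow> \<exists>i<n. v = od i"
  using od_bij by (auto simp: bij_betw_def image_iff set_eq_iff)

text \<open>In positions, the vertex sets of connected subgraphs through the root:
  \<open>rooted_closed_connected\<close> gives one direction, \<open>connected_safe_setD\<close> the
  other for safe sets.\<close>

definition rooted_closed :: "nat set \<Rightarrow> bool" where
  "rooted_closed S \<longleftrightarrow> S \<subseteq> {..<n} \<and> 0 \<in> S \<and> (\<forall>i\<in>S. 0 < i \<longrightarrow> q i \<in> S)"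

lemma rooted_closed_reachable:
  assumes "rooted_closed S" and "i \<in> S"
  shows "od 0 \<rightarrow>\<^sup>*\<^bsub>with_proj T \<restriction> (od ` S)\<^esub> od i"
  using assms(2)
proof (induction i rule: less_induct)
  case (less i)
  show ?case
  proof (cases "i = 0")
    case True then show ?thesis using less.prems by (auto intro: reachable_induced_refl)
  next
    case False
    then have "i < n" "q i \<in> S" using less.prems assms(1) by (auto simp: rooted_closed_def)
    then have "od 0 \<rightarrow>\<^sup>*\<^bsub>with_proj T \<restriction> (od ` S)\<^esub> od (q i)"
      using False less.IH[of "q i"] q_less[of i] by simp
    then show ?thesis
      by (rule reachable_induced_step) (use False \<open>i < n\<close> less.prems arc_sym[OF q_arc[of i]] in simp_all)
  qed
qed

lemma rooted_closed_connected:
  assumes "rooted_closed S"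
  shows "Digraph_Component.connected (with_proj T \<restriction> (od ` S))"
proof -
  have sub: "od ` S \<subseteq> pverts T" using assms od_less by (auto simp: rooted_closed_def verts)
  interpret H: sym_digraph "with_proj T \<restriction> (od ` S)" by (rule sym_digraph_induced[OF sub])
  have "u \<rightarrow>\<^sup>*\<^bsub>with_proj T \<restriction> (od ` S)\<^esub> v" if "u \<in> od ` S" "v \<in> od ` S" for u v
  proof -
    have "od 0 \<rightarrow>\<^sup>*\<^bsub>with_proj T \<restriction> (od ` S)\<^esub> u" "od 0 \<rightarrow>\<^sup>*\<^bsub>with_proj T \<restriction> (od ` S)\<^esub> v"
      using rooted_closed_reachable[OF assms] that by blast+
    then show ?thesis by (meson H.symmetric_reachable' H.reachable_trans)
  qed
  moreover have "od ` S \<noteq> {}" using assms by (auto simp: rooted_closed_def)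
  ultimately show ?thesis unfolding connected_induced_iff[OF sub] by blast
qed

text \<open>Every prefix \<open>{..<i}\<close> is parent-closed and hence connected. A second arc
  from position \<open>i\<close> into this prefix would close a cycle of length at least 3.\<close>

lemma arc_parent:
  assumes "i < n" "j < n" "(od i, od j) \<in> parcs T"
  shows "(0 < i \<and> q i = j) \<or> (0 < j \<and> q j = i)"
proof -
  have *: "q i = j" if "j < i" "i < n" "(od i, od j) \<in> parcs T" for i j
  proof (rule ccontr)
    assume "q i \<noteq> j"
    have sub: "od ` {..<i} \<subseteq> pverts T" using that od_less by (auto simp: verts)
    have "rooted_closed {..<i}" using that q_less
      by (auto simp: rooted_closed_def) (meson less_trans)
    then have "Digraph_Component.connected (with_proj T \<restriction> (od ` {..<i}))"
      by (rule rooted_closed_connected)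
    then have "od (q i) \<rightarrow>\<^sup>*\<^bsub>with_proj T \<restriction> (od ` {..<i})\<^esub> od j"
      using connected_induced_iff[OF sub] that q_less by auto
    moreover have "od i \<notin> od ` {..<i}" using that od_inj by fastforce
    moreover have "od (q i) \<noteq> od j" using that q_less[of i] \<open>q i \<noteq> j\<close> od_inj by auto
    ultimately have "\<exists>p. cycle p \<and> 3 \<le> length p"
      using cycle_through_vertex[OF sub, of "od i" "od (q i)" "od j"] that q_arc[of i]
        arc_sym[OF that(3)] by blast
    then show False using tree by (auto simp: undirected_tree_def)
  qed
  have "i \<noteq> j" using assms no_loops' by blast
  then show ?thesis using *[of j i] *[of i j] assms arc_sym[OF assms(3)] by (cases "i < j") auto
qed

section \<open>Subtrees and their weights\<close>

definition subtree :: "nat \<Rightarrow> nat set" where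
  "subtree i = {j. j < n \<and> (j, i) \<in> {(c, q c) |c. 0 < c \<and> c < n}\<^sup>*}"

lemma subtree_self: "i < n \<Longrightarrow> i \<in> subtree i"
  by (simp add: subtree_def)

lemma subtree_less: "j \<in> subtree i \<Longrightarrow> j < n"
  by (simp add: subtree_def)

lemma subtree_finite [simp]: "finite (subtree i)"
  by (rule finite_subset[of _ "{..<n}"]) (auto simp: subtree_def)

lemma subtree_child: "0 < c \<Longrightarrow> c < n \<Longrightarrow> q c \<in> subtree i \<Longrightarrow> c \<in> subtree i"
  unfolding subtree_def by (auto intro: converse_rtrancl_into_rtrancl)

lemma subtree_parent:
  assumes "j \<in> subtree i" "j \<noteq> i"
  shows "0 < j \<and> q j \<in> subtree i"
proof -
  from assms have "(j, i) \<in> {(c, q c) |c. 0 < c \<and> c < n}\<^sup>*" "j < n" by (auto simp: subtree_def)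
  then show ?thesis using assms(2) q_less
    by (cases rule: converse_rtranclE) (auto simp: subtree_def intro: less_trans)
qed

lemma subtree_ge: "j \<in> subtree i \<Longrightarrow> i \<le> j"
proof (induction j rule: less_induct)
  case (less j)
  show ?case
  proof (cases "j = i")
    case False
    then have "0 < j" "q j \<in> subtree i" using subtree_parent less.prems by auto
    moreover have "q j < j" using calculation less.prems subtree_less q_less by blast
    ultimately show ?thesis using less.IH by fastforce
  qed simp
qed

lemma subtree_mono:
  assumes "j \<in> subtree i" shows "subtree j \<subseteq> subtree i"
  using assms unfolding subtree_def by (auto intro: rtrancl_trans)

text \<open>Replacing \<open>j\<close> by its parent keeps it in both subtrees until it is
  \<open>c\<close> or \<open>d\<close>. If one sibling then lay strictly below the other, so would
  their common parent, against \<open>subtree_ge\<close>.\<close>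

lemma subtree_children_disjoint:
  assumes "j \<in> subtree c" "j \<in> subtree d" "0 < c" "0 < d" "c < n" "d < n" "q c = q d"
  shows "c = d"
  using assms(1,2)
proof (induction j rule: less_induct)
  case (less j)
  have *: "a = b" if "a \<in> subtree b" "q a = q b" "0 < b" "b < n" for a b
  proof (rule ccontr)
    assume "a \<noteq> b"
    then have "q b \<in> subtree b" using subtree_parent[of a b] that by simp
    then have "b \<le> q b" by (rule subtree_ge)
    then show False using q_less[of b] that by linarith
  qed
  show ?case
  proof (cases "j = c \<or> j = d")
    case True
    then consider "j = c" | "j = d" by blast
    then show ?thesis
    proof cases
      case 1 then show ?thesis using *[of c d] less.prems(2) assms(4,6,7) by simp
    next
      case 2 then show ?thesis using *[of d c] less.prems(1) assms(3,5,7) by simp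
    qed
  next
    case False
    then have "0 < j" "q j \<in> subtree c" "q j \<in> subtree d" using subtree_parent less.prems by auto
    moreover have "q j < j" using calculation less.prems subtree_less q_less by blast
    ultimately show ?thesis using less.IH by blast
  qed
qed

definition wt :: "nat \<Rightarrow> nat" where "wt i = w (od i)"

definition SW :: "nat \<Rightarrow> nat" where "SW i = sum wt (subtree i)"

definition children :: "nat \<Rightarrow> nat set" where "children i = {c. 0 < c \<and> c < n \<and> q c = i}"

text \<open>This is the recursion that \<open>push_to_parents\<close> evaluates from the last
  position upwards.\<close>

lemma SW_children:
  assumes "i < n"
  shows "SW i = wt i + sum SW (children i)"
proof -
  have fin: "finite (children i)" by (rule finite_subset[of _ "{..<n}"]) (auto simp: children_def)
  have "subtree i = insert i (\<Union>c\<in>children i. subtree c)"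
  proof (intro set_eqI iffI)
    fix j assume "j \<in> subtree i"
    then show "j \<in> insert i (\<Union>c\<in>children i. subtree c)"
    proof (induction j rule: less_induct)
      case (less j)
      show ?case
      proof (cases "j = i")
        case False
        then have j: "0 < j" "q j \<in> subtree i" "j < n" using subtree_parent less.prems subtree_less by auto
        moreover have "q j < j" using q_less j by simp
        ultimately have "q j = i \<or> (\<exists>c\<in>children i. q j \<in> subtree c)" using less.IH by blast
        then show ?thesis using j subtree_self subtree_child by (auto simp: children_def)
      qed simp
    qed
  next
    fix j assume "j \<in> insert i (\<Union>c\<in>children i. subtree c)"
    then show "j \<in> subtree i"
      using assms subtree_self subtree_mono subtree_child by (auto simp: children_def) blast
  qed
  moreover have "i \<notin> (\<Union>c\<in>children i. subtree c)"
  proof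
    assume "i \<in> (\<Union>c\<in>children i. subtree c)"
    then obtain c where "0 < c" "c < n" "q c = i" "i \<in> subtree c" by (auto simp: children_def)
    then show False using subtree_ge[of i c] q_less[of c] by linarith
  qed
  moreover have "sum wt (\<Union>c\<in>children i. subtree c) = sum SW (children i)"
    unfolding SW_def
    by (rule sum.UNION_disjoint[OF fin])
      (use subtree_children_disjoint in \<open>auto simp: children_def\<close>)
  ultimately show ?thesis using fin by (simp add: SW_def)
qed

section \<open>Connected safe sets through the root\<close>

lemma weight_od: "S \<subseteq> {..<n} \<Longrightarrow> weight w (od ` S) = sum wt S"
  unfolding weight_def wt_def
  by (subst sum.reindex) (use od_bij in \<open>auto simp: bij_betw_def intro: inj_on_subset\<close>)

text \<open>The only arc leaving the subtree of \<open>i\<close> goes from \<open>i\<close> to its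
  parent, which is not in \<open>A\<close>. This is applied to the complement of a set, to confine
  its components, and to a connected set, to show that it is parent-closed.\<close>

lemma reachable_in_subtree:
  assumes "A \<subseteq> {..<n}" and "i \<in> A" and "i = 0 \<or> q i \<notin> A"
    and "od i \<rightarrow>\<^sup>*\<^bsub>with_proj T \<restriction> (od ` A)\<^esub> v"
  shows "v \<in> od ` (A \<inter> subtree i)"
  using assms(4)
proof (induction rule: reachable_induced_induct)
  case base
  show ?case using assms subtree_self by auto
next
  case (step x y)
  then obtain a b where ab: "x = od a" "a \<in> A" "a \<in> subtree i" "y = od b" "b \<in> A" by auto
  then have "a < n" "b < n" using assms(1) by auto
  then consider "0 < a" "q a = b" | "0 < b" "q b = a"
    using arc_parent[of a b] step(2) ab by metis
  then have "b \<in> subtree i"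
  proof cases
    case 1
    then have "a \<noteq> i" using assms(3) ab by auto
    then show ?thesis using subtree_parent[of a i] ab 1 by simp
  next
    case 2
    then show ?thesis using subtree_child[of b i] \<open>b < n\<close> ab by simp
  qed
  then show ?case using ab by auto
qed

lemma connected_safe_setI:
  assumes S: "rooted_closed S" and le: "\<And>i. i < n \<Longrightarrow> i \<notin> S \<Longrightarrow> SW i \<le> sum wt S"
  shows "connected_safe_set (with_proj T) w (od ` S)"
  unfolding connected_safe_set_def safe_set_def
proof (intro conjI ballI impI)
  have Sn: "S \<subseteq> {..<n}" using S by (simp add: rooted_closed_def)
  show sub: "od ` S \<subseteq> verts (with_proj T)" using Sn od_less by (auto simp: verts)
  show conn: "Digraph_Component.connected (with_proj T \<restriction> (od ` S))"
    by (rule rooted_closed_connected[OF S])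
  fix C D
  assume C: "C \<in> components (with_proj T \<restriction> (od ` S))"
    and D: "D \<in> components (with_proj T \<restriction> (verts (with_proj T) - od ` S))"
  have sub': "od ` S \<subseteq> pverts T" using sub by simp
  obtain u where u: "u \<in> verts C" using component_induced_verts(1)[OF sub' C] by auto
  have "verts C = od ` S"
    using component_induced_verts(2)[OF sub' C] component_induced_verts(3)[OF sub' C u] u conn
    unfolding connected_induced_iff[OF sub'] by auto
  let ?A = "{..<n} - S"
  have eq: "verts (with_proj T) - od ` S = od ` ?A"
    using od_bij inj_on_image_set_diff[of od "{..<n}" "{..<n}" S] Sn by (simp add: verts bij_betw_def)
  have subA: "od ` ?A \<subseteq> pverts T" using od_less by (auto simp: verts)
  note D = D[unfolded eq]
  define B where "B = {i \<in> ?A. od i \<in> verts D}"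
  have DB: "verts D = od ` B" using component_induced_verts(2)[OF subA D] by (auto simp: B_def)
  then have "B \<noteq> {}" using component_induced_verts(1)[OF subA D] by auto
  have "finite B" by (rule finite_subset[of _ "{..<n}"]) (auto simp: B_def)
  \<comment> \<open>The top vertex of \<open>D\<close>. Its parent has a smaller position and so is
    not in \<open>D\<close>; being a neighbour of \<open>D\<close>, it is then not in the complement
    at all.\<close>
  define i where "i = Min B"
  have i: "i \<in> B" unfolding i_def using \<open>finite B\<close> \<open>B \<noteq> {}\<close> by simp
  then have "i \<in> ?A" "od i \<in> verts D" by (auto simp: B_def)
  then have "0 < i" using S by (auto simp: rooted_closed_def intro: Suc_leI gr0I)
  have reach: "verts D = {v. od i \<rightarrow>\<^sup>*\<^bsub>with_proj T \<restriction> (od ` ?A)\<^esub> v}"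
    by (rule component_induced_verts(3)[OF subA D \<open>od i \<in> verts D\<close>])
  have "q i \<notin> ?A"
  proof
    assume "q i \<in> ?A"
    then have "od (q i) \<in> verts D" unfolding reach
      using \<open>i \<in> ?A\<close> \<open>0 < i\<close> q_arc
      by (auto intro!: reachable_induced_step[OF reachable_induced_refl[where u = "od i"]])
    then have "q i \<in> B" using \<open>q i \<in> ?A\<close> by (simp add: B_def)
    then have "i \<le> q i" unfolding i_def using \<open>finite B\<close> by simp
    then show False using q_less[of i] \<open>0 < i\<close> \<open>i \<in> ?A\<close> by simp
  qed
  then have "verts D \<subseteq> od ` subtree i" unfolding reach
    using reachable_in_subtree[of ?A i] \<open>i \<in> ?A\<close> by blast
  then have "weight w (verts D) \<le> weight w (od ` subtree i)"
    unfolding weight_def by (intro sum_mono2) auto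
  also have "\<dots> = SW i" unfolding SW_def by (rule weight_od) (use subtree_less in auto)
  also have "\<dots> \<le> sum wt S" using le \<open>i \<in> ?A\<close> by simp
  also have "\<dots> = weight w (verts C)" using weight_od[OF Sn] \<open>verts C = od ` S\<close> by simp
  finally show "weight w (verts D) \<le> weight w (verts C)" .
qed

text \<open>Consider a missing vertex whose parent is in \<open>Z\<close>. Its whole subtree is
  missing, because \<open>Z\<close> is parent-closed, and lies in one component adjacent to
  \<open>U\<close>, so safety bounds its weight. Any other missing vertex has a missing parent with
  a subtree at least as heavy.\<close>

lemma connected_safe_setD:
  assumes U: "connected_safe_set (with_proj T) w U" and root: "od 0 \<in> U"
  defines "Z \<equiv> {i. i < n \<and> od i \<in> U}"
  shows "rooted_closed Z" and "sum wt Z = weight w U" and "i < n \<Longrightarrow> i \<notin> Z \<Longrightarrow> SW i \<le> weight w U"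
proof -
  have Un: "U \<subseteq> pverts T" using U by (simp add: connected_safe_set_def safe_set_def)
  have Zn: "Z \<subseteq> {..<n}" by (auto simp: Z_def)
  have UZ: "U = od ` Z" using Un od_surj by (auto simp: Z_def verts)
  have conn: "u \<rightarrow>\<^sup>*\<^bsub>with_proj T \<restriction> U\<^esub> v" if "u \<in> U" "v \<in> U" for u v
    using U that connected_induced_iff[OF Un] by (auto simp: connected_safe_set_def)
  show "sum wt Z = weight w U" using weight_od[OF Zn] UZ by simp
  have "0 \<in> Z" using root n_pos by (simp add: Z_def)
  have parent: "q i \<in> Z" if "i \<in> Z" "0 < i" for i
  proof (rule ccontr)
    assume "q i \<notin> Z"
    \<comment> \<open>A walk inside \<open>U\<close> from \<open>od i\<close> to the root would have
      to pass through the missing parent.\<close>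
    then have "od 0 \<in> od ` (Z \<inter> subtree i)"
      using reachable_in_subtree[OF Zn \<open>i \<in> Z\<close>] conn \<open>i \<in> Z\<close> root UZ by blast
    then obtain j where "j < n" "j \<in> subtree i" "od 0 = od j" using Zn by blast
    then have "0 \<in> subtree i" using od_inj[of 0 j] n_pos by simp
    then show False using subtree_ge[of 0 i] \<open>0 < i\<close> by simp
  qed
  show Z: "rooted_closed Z" using Zn \<open>0 \<in> Z\<close> parent by (auto simp: rooted_closed_def)
  show "SW i \<le> weight w U" if "i < n" "i \<notin> Z"
    using that
  proof (induction i rule: less_induct)
    case (less i)
    then have "0 < i" using \<open>0 \<in> Z\<close> by (auto intro: gr0I)
    then have qi: "q i < i" "q i < n" using q_less[of i] less.prems by simp_all
    show ?case
    proof (cases "q i \<in> Z")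
      case False
      have "i \<in> subtree (q i)" using subtree_child \<open>0 < i\<close> less.prems subtree_self qi by blast
      then have "SW i \<le> SW (q i)" unfolding SW_def using subtree_mono by (intro sum_mono2) auto
      also have "\<dots> \<le> weight w U" using less.IH qi False by blast
      finally show ?thesis .
    next
      case True
      let ?A = "pverts T - U"
      have iA: "od i \<in> ?A" using less.prems od_less by (auto simp: Z_def verts)
      obtain D where D: "D \<in> components (with_proj T \<restriction> ?A)"
        "verts D = {v. od i \<rightarrow>\<^sup>*\<^bsub>with_proj T \<restriction> ?A\<^esub> v}"
        using component_of_vertex[OF _ iA] by auto
      obtain C where C: "C \<in> components (with_proj T \<restriction> U)"
        "verts C = {v. od 0 \<rightarrow>\<^sup>*\<^bsub>with_proj T \<restriction> U\<^esub> v}"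
        using component_of_vertex[OF Un root] by auto
      have "verts C = U" using C conn root component_induced_verts(2)[OF Un C(1)] by auto
      have outside: "j \<notin> Z" if "j \<in> subtree i" for j
        using that
      proof (induction j rule: less_induct)
        case (less j)
        show ?case
        proof (cases "j = i")
          case False
          then have j: "0 < j" "q j \<in> subtree i" "j < n" using subtree_parent less.prems subtree_less by auto
          then have "q j \<notin> Z" using less.IH[of "q j"] q_less[of j] by simp
          then show ?thesis using parent j by blast
        qed (use \<open>i \<notin> Z\<close> in simp)
      qed
      have reach: "od j \<in> verts D" if "j \<in> subtree i" for j
        using that
      proof (induction j rule: less_induct)
        case (less j)
        show ?case
        proof (cases "j = i")
          case True then show ?thesis using iA D by (simp add: reachable_induced_refl)
        next
          case False
          then have j: "0 < j" "q j \<in> subtree i" "j < n" using subtree_parent less.prems subtree_less by auto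
          then have "od (q j) \<in> verts D" using less.IH[of "q j"] q_less[of j] by simp
          moreover have "od j \<in> ?A" using outside[OF less.prems] j od_less by (auto simp: Z_def verts)
          ultimately show ?thesis unfolding D(2)
            using reachable_induced_step[where u = "od i" and v = "od (q j)" and x = "od j"] arc_sym[OF q_arc, of j] j by blast
        qed
      qed
      have "finite (verts D)"
        by (rule finite_subset[of _ "pverts T"]) (use component_induced_verts(2)[OF _ D(1)] verts in auto)
      then have "weight w (od ` subtree i) \<le> weight w (verts D)"
        unfolding weight_def using reach by (intro sum_mono2) auto
      moreover have "weight w (od ` subtree i) = SW i"
        unfolding SW_def by (rule weight_od) (use subtree_less in auto)
      moreover have "adjacent_in (with_proj T) C D"
        unfolding adjacent_in_def \<open>verts C = U\<close>
        using True arc_sym[OF q_arc, of i] less.prems \<open>0 < i\<close> reach[OF subtree_self]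
        by (intro bexI[of _ "od (q i)"] bexI[of _ "od i"]) (auto simp: Z_def)
      then have "weight w (verts D) \<le> weight w (verts C)"
        using U C(1) D(1) by (auto simp: connected_safe_set_def safe_set_def)
      ultimately show ?thesis using \<open>verts C = U\<close> by simp
    qed
  qed
qed

end

subsection \<open>Completing a tuple of vertices to a safe set\<close>

text \<open>
  Memory layout besides the input and output arrays: 5 the tuple, 6 the position of a vertex in the
  traversal order plus one (0 if not reached), 7 the vertices in traversal order, 8 the position of
  the parent, 9 the number of reached vertices, 10 subtree weights, 11 membership in the set under
  construction, 12 its weight, 13 the best weight so far plus one (0 if there is none), 14 the root,
  15 to 17 loop counters. Arrays 8, 10, 11 and the tuple are indexed by positions, not by vertices.
\<close>

abbreviation reg :: "nat \<Rightarrow> aexp" where "reg a \<equiv> Cell a (Num 0)"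

definition load_weights :: com where
  "load_weights = For 17 0 (reg 0)
    (Seq (Assign 10 (reg 17) (Cell 1 (Cell 7 (reg 17)))) (Assign 11 (reg 17) (Num 0)))"

text \<open>Entry 0 of the tuple only names the threshold, so marking starts with entry 1. Position
  0 is the root.\<close>

definition mark_tuple :: "nat \<Rightarrow> com" where
  "mark_tuple k = Seq (Assign 11 (Num 0) (Num 1))
    (For 17 0 (Num (k - 1)) (Assign 11 (Cell 5 (Add (reg 17) (Num 1))) (Num 1)))"

abbreviation from_end :: aexp where "from_end \<equiv> Sub (Sub (reg 0) (Num 1)) (reg 17)"

text \<open>\<open>from_end\<close> runs from \<open>n - 1\<close> down to 1; the root has no
  parent. When a position is reached its children are done, so its cell holds the full subtree
  weight and its mark is final.\<close>

definition push_to_parents :: com where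
  "push_to_parents = For 17 0 (Sub (reg 0) (Num 1))
    (Seq (Assign 10 (Cell 8 from_end) (Add (Cell 10 (Cell 8 from_end)) (Cell 10 from_end)))
      (Cond (Less (Num 0) (Cell 11 from_end)) (Assign 11 (Cell 8 from_end) (Num 1)) Skip))"

abbreviation threshold :: aexp where "threshold \<equiv> Cell 10 (Cell 5 (Num 0))"

abbreviation weight_at :: "aexp \<Rightarrow> aexp" where "weight_at e \<equiv> Cell 1 (Cell 7 e)"

definition mark_heavy_subtrees :: com where
  "mark_heavy_subtrees = Seq (Assign 12 (Num 0) (Num 0))
    (For 17 0 (reg 0)
      (Seq (Cond (Less threshold (Cell 10 (reg 17))) (Assign 11 (reg 17) (Num 1)) Skip)
        (Cond (Less (Num 0) (Cell 11 (reg 17)))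
          (Assign 12 (Num 0) (Add (reg 12) (weight_at (reg 17)))) Skip)))"

definition add_light_vertices :: com where
  "add_light_vertices = For 17 0 (reg 0)
    (Cond (Conj (Conj (Neg (Less (Num 0) (Cell 11 (reg 17)))) (Less (reg 12) threshold))
        (Conj (Less (Num 0) (Cell 11 (Cell 8 (reg 17))))
          (Neg (Less (weight_at (Cell 5 (Num 1))) (weight_at (reg 17))))))
      (Seq (Assign 11 (reg 17) (Num 1)) (Assign 12 (Num 0) (Add (reg 12) (weight_at (reg 17)))))
      Skip)"

text \<open>The negated conjunction expresses a disjunction: there is no record yet, or the new
  weight is strictly smaller. All \<open>n\<close> output cells are rewritten, which erases the
  previous set.\<close>

definition record_best :: com where
  "record_best = Cond
    (Conj (Neg (Less (reg 12) threshold))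
      (Neg (Conj (Less (Num 0) (reg 13)) (Neg (Less (Add (reg 12) (Num 1)) (reg 13))))))
    (Seq (Assign 13 (Num 0) (Add (reg 12) (Num 1)))
      (For 17 0 (reg 0) (Assign 4 (Cell 7 (reg 17)) (Cell 11 (reg 17)))))
    Skip"

definition try_tuple :: "nat \<Rightarrow> com" where
  "try_tuple k = Seq load_weights (Seq (mark_tuple k) (Seq push_to_parents
    (Seq mark_heavy_subtrees (Seq add_light_vertices record_best))))"

section \<open>Correctness of the phases of a single trial\<close>

context rooted_tree begin

definition env :: "memory \<Rightarrow> bool" where
  "env M \<longleftrightarrow> M 0 0 = n \<and> (\<forall>v<n. M 1 v = w v) \<and> M 7 = od \<and> M 8 = q"

definition marked :: "memory \<Rightarrow> nat set" where
  "marked M = {i. i < n \<and> 0 < M 11 i}"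

lemma finite_marked [simp]: "finite (marked M)"
  by (simp add: marked_def)

lemma env_wt: "env M \<Longrightarrow> i < n \<Longrightarrow> M 1 (od i) = wt i"
  using od_less by (simp add: env_def wt_def)

lemma env_cong: "env M \<Longrightarrow> M' 0 = M 0 \<Longrightarrow> M' 1 = M 1 \<Longrightarrow> M' 7 = M 7 \<Longrightarrow> M' 8 = M 8 \<Longrightarrow> env M'"
  by (simp add: env_def)

lemma runs_load_weights:
  assumes "env M"
  shows "runs load_weights M (9 + n * 60) (\<lambda>M'. (\<forall>i<n. M' 10 i = wt i) \<and> marked M' = {})"
proof -
  have "runs load_weights M (7 + atime (reg 0) + n * (40 + atime (reg 0) + 10))
    (\<lambda>M'. \<forall>j<n. M' 10 j = wt j \<and> M' 11 j = 0)"
    unfolding load_weights_def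
  proof (rule runs_For[where I = "\<lambda>i N. \<forall>j<i. N 10 j = wt j \<and> N 11 j = 0"])
    fix i N assume *: "i < n" "\<forall>j<i. N 10 j = wt j \<and> N 11 j = 0" "N 17 0 = i"
      and fr: "same_outside (insert 17 (writes (Seq (Assign 10 (reg 17) (Cell 1 (Cell 7 (reg 17))))
        (Assign 11 (reg 17) (Num 0))))) M N"
    have "env N" by (rule env_cong[OF assms]) (use fr in auto)
    then have "N 7 = od" "N 1 (od i) = wt i" using env_wt * by (auto simp: env_def)
    then show "runs (Seq (Assign 10 (reg 17) (Cell 1 (Cell 7 (reg 17)))) (Assign 11 (reg 17) (Num 0))) N 40
      (\<lambda>N'. N' 17 0 = i \<and> (\<forall>j<Suc i. (N'(17 := (N' 17)(0 := Suc i))) 10 j = wt j \<and>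
        (N'(17 := (N' 17)(0 := Suc i))) 11 j = 0))"
      using * by (intro runs_straight) (auto simp: less_Suc_eq)
  qed (use assms in \<open>auto simp: env_def\<close>)
  then show ?thesis by (rule runs_weaken) (auto simp: marked_def)
qed

lemma runs_mark_tuple:
  assumes "env M" and "marked M = {}" and "\<And>j. j < k \<Longrightarrow> M 5 j < n"
  shows "runs (mark_tuple k) M (11 + k * 60) (\<lambda>M'. marked M' = insert 0 (M 5 ` {1..<k}))"
proof -
  let ?M = "M(11 := (M 11)(0 := 1))"
  have "runs (mark_tuple k) M (3 + (7 + atime (Num (k - 1)) + (k - 1) * (40 + atime (Num (k - 1)) + 10)))
    (\<lambda>M'. marked M' = insert 0 (M 5 ` {1..<Suc (k - 1)}))"
    unfolding mark_tuple_def
  proof (rule runs_Seq)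
    show "runs (Assign 11 (Num 0) (Num 1)) M 3 (\<lambda>M'. M' = ?M)"
      by (rule runs_straight) auto
    fix M' assume M': "M' = ?M"
    show "runs (For 17 0 (Num (k - 1)) (Assign 11 (Cell 5 (Add (reg 17) (Num 1))) (Num 1))) M'
      (7 + atime (Num (k - 1)) + (k - 1) * (40 + atime (Num (k - 1)) + 10))
      (\<lambda>M'. marked M' = insert 0 (M 5 ` {1..<Suc (k - 1)}))"
    proof (rule runs_For[where I = "\<lambda>i N. marked N = insert 0 (M 5 ` {1..<Suc i})"])
      show "marked (M'(17 := (M' 17)(0 := 0))) = insert 0 (M 5 ` {1..<Suc 0})"
        using assms(2) n_pos by (auto simp: M' marked_def)
      fix i N assume *: "i < k - 1" "marked N = insert 0 (M 5 ` {1..<Suc i})" "N 17 0 = i"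
        and fr: "same_outside (insert 17 (writes (Assign 11 (Cell 5 (Add (reg 17) (Num 1))) (Num 1)))) M' N"
      have "N 5 = M 5" using fr M' by auto
      moreover have "M 5 (Suc i) < n" using assms(3) * by auto
      moreover have "{1..<Suc (Suc i)} = insert (Suc i) {1..<Suc i}" by auto
      moreover have "marked (N(11 := (N 11)(M 5 (Suc i) := 1), 17 := f)) = insert (M 5 (Suc i)) (marked N)" for f
        using \<open>M 5 (Suc i) < n\<close> by (auto simp: marked_def)
      ultimately show "runs (Assign 11 (Cell 5 (Add (reg 17) (Num 1))) (Num 1)) N 40
        (\<lambda>N'. N' 17 0 = i \<and> marked (N'(17 := (N' 17)(0 := Suc i))) = insert 0 (M 5 ` {1..<Suc (Suc i)}))"
        using * by (intro runs_straight) auto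
    qed auto
  qed simp
  moreover have "{1..<Suc (k - 1)} = {1..<k}" by auto
  moreover have "(k - 1) * 51 \<le> k * 60" by (intro mult_le_mono) auto
  ultimately show ?thesis by (elim runs_weaken) auto
qed

text \<open>The content of cell \<open>i\<close> of array 10 once the positions from
  \<open>l\<close> on have been pushed to their parents.\<close>

definition partial_SW :: "nat \<Rightarrow> nat \<Rightarrow> nat" where
  "partial_SW l i = wt i + sum SW {c \<in> children i. l \<le> c}"

lemma partial_SW_all: "partial_SW n i = wt i"
proof -
  have "{c \<in> children i. n \<le> c} = {}" by (auto simp: children_def)
  then show ?thesis unfolding partial_SW_def by (simp only: sum.empty add_0_right)
qed

lemma partial_SW_eq:
  assumes "i < n" and "l \<le> Suc i"
  shows "partial_SW l i = SW i"
proof -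
  have "{c \<in> children i. l \<le> c} = children i"
  proof -
    have "l \<le> c" if "c \<in> children i" for c
      using that q_less[of c] assms(2) by (auto simp: children_def)
    then show ?thesis by auto
  qed
  then show ?thesis using SW_children[OF assms(1)] by (simp add: partial_SW_def)
qed

lemma partial_SW_step:
  assumes "0 < l" and "l < n"
  shows "partial_SW l i = (if i = q l then partial_SW (Suc l) i + SW l else partial_SW (Suc l) i)"
proof (cases "i = q l")
  case True
  have "{c \<in> children i. l \<le> c} = insert l {c \<in> children i. Suc l \<le> c}"
    using assms True by (auto simp: children_def)
  moreover have "finite {c \<in> children i. Suc l \<le> c}"
    by (rule finite_subset[of _ "{..<n}"]) (auto simp: children_def)
  ultimately show ?thesis using True by (simp add: partial_SW_def)
next
  case False
  have "{c \<in> children i. l \<le> c} = {c \<in> children i. Suc l \<le> c}"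
    using False by (auto simp: children_def Suc_le_eq order_le_less)
  then show ?thesis using False by (simp add: partial_SW_def)
qed

text \<open>Minimality is what places the closure of a right guess inside the set that it
  describes.\<close>

definition least_closed :: "nat set \<Rightarrow> nat set \<Rightarrow> bool" where
  "least_closed X S \<longleftrightarrow> rooted_closed S \<and> X \<subseteq> S \<and> (\<forall>Z. rooted_closed Z \<and> X \<subseteq> Z \<longrightarrow> S \<subseteq> Z)"

lemma runs_push_to_parents:
  assumes "env M" and "\<And>i. i < n \<Longrightarrow> M 10 i = wt i" and "marked M = insert 0 X"
  shows "runs push_to_parents M (11 + n * 100)
    (\<lambda>M'. (\<forall>i<n. M' 10 i = SW i) \<and> least_closed X (marked M'))"
proof -
  let ?e = "Sub (reg 0) (Num 1)"
  \<comment> \<open>After \<open>i\<close> rounds the positions from \<open>n - i\<close> on are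
    done. The last conjunct carries minimality through the loop: a mark is only ever passed to a
    parent, which every closed superset of \<open>X\<close> contains as well.\<close>
  define I where "I i N \<longleftrightarrow> (\<forall>j<n. N 10 j = partial_SW (n - i) j) \<and> insert 0 X \<subseteq> marked N \<and>
      (\<forall>c\<in>marked N. n - i \<le> c \<and> 0 < c \<longrightarrow> q c \<in> marked N) \<and>
      (\<forall>Z. rooted_closed Z \<and> X \<subseteq> Z \<longrightarrow> marked N \<subseteq> Z)" for i and N :: memory
  have "runs push_to_parents M (7 + atime ?e + (n - 1) * (80 + atime ?e + 10)) (I (n - 1))"
    unfolding push_to_parents_def
  proof (rule runs_For)
    have "marked (M(17 := (M 17)(0 := 0))) = insert 0 X" using assms(3) by (simp add: marked_def)
    moreover have "\<not> n \<le> c" if "c \<in> insert 0 X" for c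
      using that unfolding assms(3)[symmetric] by (simp add: marked_def)
    moreover have "\<forall>Z. rooted_closed Z \<and> X \<subseteq> Z \<longrightarrow> insert 0 X \<subseteq> Z"
      unfolding rooted_closed_def by blast
    ultimately show "I 0 (M(17 := (M 17)(0 := 0)))"
      unfolding I_def diff_zero partial_SW_all using assms(2) by simp
    fix i and N :: memory
    let ?c = "Seq (Assign 10 (Cell 8 from_end) (Add (Cell 10 (Cell 8 from_end)) (Cell 10 from_end)))
      (Cond (Less (Num 0) (Cell 11 from_end)) (Assign 11 (Cell 8 from_end) (Num 1)) Skip)"
    assume *: "i < n - 1" "I i N" "N 17 0 = i"
      and fr: "same_outside (insert 17 (writes ?c)) M N"
    have env: "env N" by (rule env_cong[OF assms(1)]) (use fr in auto)
    define l where "l = n - 1 - i"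
    have l: "0 < l" "l < n" "n - i = Suc l" "n - Suc i = l" using * by (auto simp: l_def)
    have ql: "q l < l" "q l < n" using q_less[of l] l by auto
    have e: "aval from_end N' = l" if "N' 0 = N 0" "N' 17 = N 17" for N'
      using env * that by (simp add: env_def l_def)
    have N8: "N 8 = q" using env by (simp add: env_def)
    have Nl: "N 10 l = SW l" using * l partial_SW_eq[of l "Suc l"] by (simp add: I_def)
    define R where "R = (result ?c N)(17 := ((result ?c N) 17)(0 := Suc i))"
    have R10: "R 10 = (N 10)(q l := N 10 (q l) + SW l)"
      using Nl N8 e ql by (simp add: R_def)
    have R11: "R 11 = (if 0 < N 11 l then (N 11)(q l := 1) else N 11)"
      using Nl N8 e ql by (simp add: R_def)
    have mk: "marked R = (if l \<in> marked N then insert (q l) (marked N) else marked N)"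
      using R11 ql l by (auto simp: marked_def)
    have "I (Suc i) R" unfolding I_def l(4)
    proof (intro conjI)
      show "\<forall>j<n. R 10 j = partial_SW l j"
        using * l partial_SW_step[OF l(1,2)] by (simp add: R10 I_def)
      show "insert 0 X \<subseteq> marked R" using * mk by (auto simp: I_def)
      show "\<forall>c\<in>marked R. l \<le> c \<and> 0 < c \<longrightarrow> q c \<in> marked R"
      proof (intro ballI impI)
        fix c assume c: "c \<in> marked R" "l \<le> c \<and> 0 < c"
        show "q c \<in> marked R"
        proof (cases "c = l")
          case True then show ?thesis using c mk ql by (auto split: if_splits)
        next
          case False
          then have "c \<in> marked N" "Suc l \<le> c" using c mk ql by (auto split: if_splits)
          then have "q c \<in> marked N" using * l(3) c by (auto simp: I_def)
          then show ?thesis using mk by auto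
        qed
      qed
      show "\<forall>Z. rooted_closed Z \<and> X \<subseteq> Z \<longrightarrow> marked R \<subseteq> Z"
      proof (intro allI impI)
        fix Z assume Z: "rooted_closed Z \<and> X \<subseteq> Z"
        then have "marked N \<subseteq> Z" using *(2) unfolding I_def by blast
        moreover have "q l \<in> Z" if "l \<in> Z" using Z that l(1) by (simp add: rooted_closed_def)
        ultimately show "marked R \<subseteq> Z" unfolding mk by (simp add: subset_iff)
      qed
    qed
    moreover have "result ?c N 17 0 = i" using * by simp
    ultimately show "runs ?c N 80 (\<lambda>N'. N' 17 0 = i \<and> I (Suc i) (N'(17 := (N' 17)(0 := Suc i))))"
      by (intro runs_straight) (auto simp: R_def simp del: result.simps)
  qed (use assms(1) in \<open>simp add: env_def\<close>)
  \<comment> \<open>The number 94 is \<open>80 + atime ?e + 10\<close>, the cost of one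
    round.\<close>
  moreover have "7 + atime ?e + (n - 1) * (80 + atime ?e + 10) \<le> 11 + n * 100"
    using mult_le_mono[of "n - 1" n 94 100] by simp
  moreover have "(\<forall>i<n. M' 10 i = SW i) \<and> least_closed X (marked M')" if "I (n - 1) M'" for M'
  proof -
    have "n - (n - 1) = Suc 0" using n_pos by simp
    then have "\<forall>i<n. M' 10 i = SW i" using that partial_SW_eq[of _ "Suc 0"] by (simp add: I_def)
    moreover have "marked M' \<subseteq> {..<n}" by (auto simp: marked_def)
    moreover have "insert 0 X \<subseteq> marked M'" "\<forall>c\<in>marked M'. 0 < c \<longrightarrow> q c \<in> marked M'"
      "\<forall>Z. rooted_closed Z \<and> X \<subseteq> Z \<longrightarrow> marked M' \<subseteq> Z"
      using that \<open>n - (n - 1) = Suc 0\<close> by (simp_all add: I_def Suc_le_eq)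
    ultimately show ?thesis unfolding least_closed_def rooted_closed_def by blast
  qed
  ultimately show ?thesis by (elim runs_weaken) auto
qed

lemma runs_mark_heavy_subtrees:
  assumes "env M" and "\<And>i. i < n \<Longrightarrow> M 10 i = SW i" and "M 5 0 < n"
  defines "S \<equiv> marked M \<union> {i. i < n \<and> SW (M 5 0) < SW i}"
  shows "runs mark_heavy_subtrees M (12 + n * 100) (\<lambda>M'. marked M' = S \<and> M' 12 0 = sum wt S)"
proof -
  let ?c = "Seq (Cond (Less threshold (Cell 10 (reg 17))) (Assign 11 (reg 17) (Num 1)) Skip)
        (Cond (Less (Num 0) (Cell 11 (reg 17)))
          (Assign 12 (Num 0) (Add (reg 12) (weight_at (reg 17)))) Skip)"
  \<comment> \<open>Marks below \<open>i\<close> are final, so they can be totalled in the same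
    pass.\<close>
  define I where "I i N \<longleftrightarrow> marked N = marked M \<union> {j \<in> S. j < i} \<and> N 12 0 = sum wt {j \<in> S. j < i}"
    for i and N :: memory
  have "runs mark_heavy_subtrees M (3 + (7 + atime (reg 0) + n * (80 + atime (reg 0) + 10))) (I n)"
    unfolding mark_heavy_subtrees_def
  proof (rule runs_Seq)
    show "runs (Assign 12 (Num 0) (Num 0)) M 3 (\<lambda>M'. M' = M(12 := (M 12)(0 := 0)))"
      by (rule runs_straight) auto
    fix M' assume M': "M' = M(12 := (M 12)(0 := 0))"
    show "runs (For 17 0 (reg 0) ?c) M' (7 + atime (reg 0) + n * (80 + atime (reg 0) + 10)) (I n)"
    proof (rule runs_For)
      show "I 0 (M'(17 := (M' 17)(0 := 0)))" by (simp add: I_def M' marked_def)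
      fix i and N :: memory
      assume *: "i < n" "I i N" "N 17 0 = i" and fr: "same_outside (insert 17 (writes ?c)) M' N"
      have env: "env N" by (rule env_cong[OF assms(1)]) (use fr M' in auto)
      have N: "N 10 = M 10" "N 5 = M 5" "N 7 = od" "N 1 (od i) = wt i"
        using fr M' env env_wt * by (auto simp: env_def)
      have iS: "i \<in> S \<longleftrightarrow> 0 < N 11 i \<or> SW (M 5 0) < SW i"
        using * by (auto simp: S_def I_def marked_def)
      define R where "R = (result ?c N)(17 := ((result ?c N) 17)(0 := Suc i))"
      have mk: "marked R = (if i \<in> S then insert i (marked N) else marked N)"
        using * N assms(2,3) iS by (auto simp: R_def marked_def)
      have tot: "R 12 0 = (if i \<in> S then N 12 0 + wt i else N 12 0)"
        using * N assms(2,3) iS by (simp add: R_def)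
      have S_Suc: "{j \<in> S. j < Suc i} = (if i \<in> S then insert i {j \<in> S. j < i} else {j \<in> S. j < i})"
        by (auto simp: less_Suc_eq)
      have "I (Suc i) R" using *(2) unfolding I_def mk tot S_Suc by simp
      moreover have "result ?c N 17 0 = i" using * by simp
      ultimately show "runs ?c N 80 (\<lambda>N'. N' 17 0 = i \<and> I (Suc i) (N'(17 := (N' 17)(0 := Suc i))))"
        by (intro runs_straight) (auto simp: R_def simp del: result.simps)
    qed (use assms(1) M' in \<open>auto simp: env_def\<close>)
  qed simp
  moreover have "{j \<in> S. j < n} = S" "marked M \<subseteq> S" by (auto simp: S_def marked_def)
  ultimately show ?thesis by (elim runs_weaken) (auto simp: I_def)
qed

text \<open>
  \<open>good k x Z \<delta>\<close>: the tuple \<open>x\<close> describes the safe set \<open>Z\<close>. The entry \<open>x 0\<close> fixes the threshold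
  for forced subtrees, the entries \<open>x 1, \<dots>, x (k - 1)\<close> contain all vertices of \<open>Z\<close> that are
  heavier than \<open>\<delta>\<close>, and the weight of \<open>x 1\<close> bounds the weights of the remaining ones.
\<close>

definition good :: "nat \<Rightarrow> (nat \<Rightarrow> nat) \<Rightarrow> nat set \<Rightarrow> nat \<Rightarrow> bool" where
  "good k x Z \<delta> \<longleftrightarrow> rooted_closed Z \<and> x ` {1..<k} \<subseteq> Z \<and>
    (\<forall>i\<in>Z. i \<in> x ` {1..<k} \<or> wt i \<le> wt (x 1)) \<and> (Z \<subseteq> x ` {1..<k} \<or> wt (x 1) \<le> \<delta>) \<and>
    SW (x 0) \<le> sum wt Z \<and> (\<forall>i<n. SW (x 0) < SW i \<longrightarrow> i \<in> Z)"

text \<open>Subtree weights do not decrease towards the root, so exceeding \<open>b\<close> passes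
  from a vertex to its parent.\<close>

lemma rooted_closed_heavy:
  assumes "rooted_closed S"
  shows "rooted_closed (S \<union> {i. i < n \<and> b < SW i})"
proof -
  have "q i < n \<and> b < SW (q i)" if "0 < i" "i < n" "b < SW i" for i
  proof -
    have "q i < n" using q_less[of i] that by simp
    then have "i \<in> subtree (q i)" using subtree_child that subtree_self by blast
    then have "SW i \<le> SW (q i)" unfolding SW_def using subtree_mono by (intro sum_mono2) auto
    then show ?thesis using that \<open>q i < n\<close> by simp
  qed
  then show ?thesis using assms unfolding rooted_closed_def by blast
qed

text \<open>The heart of the approximation. Initially all marks lie in every \<open>Z\<close> that
  the tuple describes. A vertex is added only while the total is below
  \<open>SW (M 5 0) \<le> sum wt Z\<close>, and it weighs at most
  \<open>wt (M 5 1) \<le> \<delta>\<close>, so the total stays within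
  \<open>sum wt Z + \<delta>\<close>. If the threshold were never reached, no member of
  \<open>Z\<close> would have been refused, and the total would be at least \<open>sum wt Z\<close>.
  \<open>Z\<close> and \<open>\<delta>\<close> are quantified in the postcondition because the
  program does not know them.\<close>

lemma runs_add_light_vertices:
  assumes "env M" and "\<And>i. i < n \<Longrightarrow> M 10 i = SW i" and "M 5 0 < n" and "M 5 1 < n"
    and "least_closed X S\<^sub>0" and "X = M 5 ` {1..<k}"
    and "marked M = S\<^sub>0 \<union> {i. i < n \<and> SW (M 5 0) < SW i}" and "M 12 0 = sum wt (marked M)"
  shows "runs add_light_vertices M (9 + n * 100) (\<lambda>M'. rooted_closed (marked M') \<and>
    M' 12 0 = sum wt (marked M') \<and> (\<forall>i<n. SW (M 5 0) < SW i \<longrightarrow> i \<in> marked M') \<and>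
    (\<forall>Z \<delta>. good k (M 5) Z \<delta> \<longrightarrow>
      SW (M 5 0) \<le> sum wt (marked M') \<and> sum wt (marked M') \<le> sum wt Z + \<delta>))"
proof -
  let ?c = "Cond (Conj (Conj (Neg (Less (Num 0) (Cell 11 (reg 17)))) (Less (reg 12) threshold))
        (Conj (Less (Num 0) (Cell 11 (Cell 8 (reg 17))))
          (Neg (Less (weight_at (Cell 5 (Num 1))) (weight_at (reg 17))))))
      (Seq (Assign 11 (reg 17) (Num 1)) (Assign 12 (Num 0) (Add (reg 12) (weight_at (reg 17)))))
      Skip"
  let ?\<mu> = "SW (M 5 0)"
  define I where "I i N \<longleftrightarrow> rooted_closed (marked N) \<and> marked M \<subseteq> marked N \<and>
      N 12 0 = sum wt (marked N) \<and>
      (\<forall>Z \<delta>. good k (M 5) Z \<delta> \<longrightarrow> sum wt (marked N) \<le> sum wt Z + \<delta> \<and>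
        (?\<mu> \<le> sum wt (marked N) \<or> (\<forall>j\<in>Z. j < i \<longrightarrow> j \<in> marked N)))"
    for i and N :: memory
  have closedM: "rooted_closed (marked M)"
    using assms(5) rooted_closed_heavy unfolding assms(7) least_closed_def by blast
  have "X \<subseteq> marked M" using assms(5,7) by (auto simp: least_closed_def)
  have finZ: "finite Z" if "rooted_closed Z" for Z
    using that by (auto simp: rooted_closed_def intro: finite_subset)
  have goodM: "marked M \<subseteq> Z" if "good k (M 5) Z \<delta>" for Z \<delta>
    using that assms(5,6) unfolding assms(7) good_def least_closed_def by blast
  have "runs add_light_vertices M (7 + atime (reg 0) + n * (80 + atime (reg 0) + 10)) (I n)"
    unfolding add_light_vertices_def
  proof (rule runs_For)
    have "sum wt (marked M) \<le> sum wt Z + \<delta>" if "good k (M 5) Z \<delta>" for Z \<delta>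
    proof -
      have "sum wt (marked M) \<le> sum wt Z"
        using goodM[OF that] that finZ by (intro sum_mono2) (auto simp: good_def)
      then show ?thesis by simp
    qed
    moreover have "marked (M(17 := f)) = marked M" for f by (simp add: marked_def)
    ultimately show "I 0 (M(17 := (M 17)(0 := 0)))"
      using closedM assms(8) by (simp add: I_def)
    fix i and N :: memory
    assume *: "i < n" "I i N" "N 17 0 = i" and fr: "same_outside (insert 17 (writes ?c)) M N"
    have env: "env N" by (rule env_cong[OF assms(1)]) (use fr in auto)
    have N: "N 10 = M 10" "N 5 = M 5" "N 7 = od" "N 8 = q" "N 1 (od i) = wt i"
      "N 1 (od (M 5 1)) = wt (M 5 1)"
      using fr env env_wt * assms(4) by (auto simp: env_def)
    have closedN: "rooted_closed (marked N)" and totN: "N 12 0 = sum wt (marked N)"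
      using * by (auto simp: I_def)
    define R where "R = (result ?c N)(17 := ((result ?c N) 17)(0 := Suc i))"
    \<comment> \<open>The value \<open>q 0\<close> is arbitrary, but the root is always marked, so
      the test of the parent matters at positive positions only.\<close>
    have qi: "0 < N 11 (q i) \<longleftrightarrow> q i \<in> marked N" if "i \<notin> marked N"
    proof -
      have "i \<noteq> 0" using that closedN unfolding rooted_closed_def by metis
      then show ?thesis using q_less[of i] * by (simp add: marked_def)
    qed
    define add where "add \<longleftrightarrow> i \<notin> marked N \<and> sum wt (marked N) < ?\<mu> \<and> q i \<in> marked N \<and> wt i \<le> wt (M 5 1)"
    have b: "bval (Conj (Conj (Neg (Less (Num 0) (Cell 11 (reg 17)))) (Less (reg 12) threshold))
        (Conj (Less (Num 0) (Cell 11 (Cell 8 (reg 17))))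
          (Neg (Less (weight_at (Cell 5 (Num 1))) (weight_at (reg 17)))))) N \<longleftrightarrow> add"
      using * N assms(2)[OF assms(3)] totN qi by (auto simp: add_def marked_def)
    have mk: "marked R = (if add then insert i (marked N) else marked N)"
      using b * by (auto simp: R_def marked_def simp del: bval.simps)
    have tot: "R 12 0 = (if add then N 12 0 + wt i else N 12 0)"
      using b * N by (simp add: R_def del: bval.simps)
    have sum_mk: "sum wt (marked R) = (if add then sum wt (marked N) + wt i else sum wt (marked N))"
      unfolding mk by (simp add: add_def)
    have "I (Suc i) R" unfolding I_def
    proof (intro conjI allI impI)
      show "rooted_closed (marked R)" using closedN * unfolding mk
        by (auto simp: rooted_closed_def add_def)
      show "marked M \<subseteq> marked R" using * mk by (auto simp: I_def)
      show "R 12 0 = sum wt (marked R)" using totN tot sum_mk by simp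
      fix Z \<delta> assume good: "good k (M 5) Z \<delta>"
      have inv: "\<forall>Z \<delta>. good k (M 5) Z \<delta> \<longrightarrow> sum wt (marked N) \<le> sum wt Z + \<delta> \<and>
        (?\<mu> \<le> sum wt (marked N) \<or> (\<forall>j\<in>Z. j < i \<longrightarrow> j \<in> marked N))"
        using *(2) unfolding I_def by (elim conjE)
      have Z: "sum wt (marked N) \<le> sum wt Z + \<delta>"
        "?\<mu> \<le> sum wt (marked N) \<or> (\<forall>j\<in>Z. j < i \<longrightarrow> j \<in> marked N)" "?\<mu> \<le> sum wt Z" "rooted_closed Z"
        using inv[rule_format, OF good] good by (simp_all add: good_def)
      show "sum wt (marked R) \<le> sum wt Z + \<delta>"
      proof (cases add)
        case True
        \<comment> \<open>If the tuple listed all of \<open>Z\<close>, the marks would weigh at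
          least \<open>?\<mu>\<close> from the start and nothing would be added. So
          \<open>good\<close> must supply its other alternative,
          \<open>wt (M 5 1) \<le> \<delta>\<close>.\<close>
        have "\<not> Z \<subseteq> X"
        proof
          assume "Z \<subseteq> X"
          then have "Z \<subseteq> marked N" using \<open>X \<subseteq> marked M\<close> * by (auto simp: I_def)
          then have "sum wt Z \<le> sum wt (marked N)" by (intro sum_mono2) auto
          then show False using True Z(3) by (simp add: add_def)
        qed
        then have "wt (M 5 1) \<le> \<delta>" using good assms(6) by (auto simp: good_def)
        then show ?thesis using True Z(3) unfolding sum_mk by (simp add: add_def)
      qed (use Z(1) sum_mk in simp)
      show "?\<mu> \<le> sum wt (marked R) \<or> (\<forall>j\<in>Z. j < Suc i \<longrightarrow> j \<in> marked R)"
      proof (cases "?\<mu> \<le> sum wt (marked N)")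
        case False
        then have below: "\<forall>j\<in>Z. j < i \<longrightarrow> j \<in> marked N" using Z(2) by simp
        have "i \<in> marked R" if "i \<in> Z"
        proof (cases "i \<in> marked N")
          case notin: False
          then have "i \<noteq> 0" using closedN unfolding rooted_closed_def by metis
          then have "q i \<in> marked N"
            using below that Z(4) q_less[of i] * by (auto simp: rooted_closed_def)
          moreover have "i \<notin> X" using notin \<open>X \<subseteq> marked M\<close> * by (auto simp: I_def)
          then have "wt i \<le> wt (M 5 1)" using good that assms(6) by (auto simp: good_def)
          ultimately have add using notin False by (simp add: add_def)
          then show ?thesis using mk by simp
        qed (use mk in simp)
        then show ?thesis using below mk by (auto simp: less_Suc_eq)
      qed (use sum_mk in simp)
    qed
    moreover have "result ?c N 17 0 = i" using * by simp
    ultimately show "runs ?c N 80 (\<lambda>N'. N' 17 0 = i \<and> I (Suc i) (N'(17 := (N' 17)(0 := Suc i))))"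
      by (intro runs_straight) (auto simp: R_def simp del: result.simps)
  qed (use assms(1) in \<open>auto simp: env_def\<close>)
  moreover have "?\<mu> \<le> sum wt (marked M')" if "I n M'" "good k (M 5) Z \<delta>" for M' Z \<delta>
  proof (rule ccontr)
    assume "\<not> ?\<mu> \<le> sum wt (marked M')"
    moreover have "\<forall>Z \<delta>. good k (M 5) Z \<delta> \<longrightarrow> sum wt (marked M') \<le> sum wt Z + \<delta> \<and>
        (?\<mu> \<le> sum wt (marked M') \<or> (\<forall>j\<in>Z. j < n \<longrightarrow> j \<in> marked M'))"
      using that(1) unfolding I_def by (elim conjE)
    moreover have "Z \<subseteq> {..<n}" using that(2) by (simp add: good_def rooted_closed_def)
    ultimately have "Z \<subseteq> marked M'" using that(2) by blast
    then have "sum wt Z \<le> sum wt (marked M')" by (intro sum_mono2) auto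
    then show False using that(2) \<open>\<not> ?\<mu> \<le> sum wt (marked M')\<close> by (simp add: good_def)
  qed
  moreover have "i \<in> marked M" if "i < n" "?\<mu> < SW i" for i using that assms(7) by auto
  ultimately show ?thesis by (elim runs_weaken) (auto simp: I_def)
qed

text \<open>Whatever is recorded has reached the threshold and contains all vertices with heavier
  subtrees, so \<open>connected_safe_setI\<close> applies. No \<open>good\<close> tuple is assumed:
  this makes wrong guesses harmless.\<close>

lemma runs_record_best:
  assumes "env M" and "\<And>i. i < n \<Longrightarrow> M 10 i = SW i" and "M 5 0 < n"
    and "rooted_closed (marked M)" and "M 12 0 = sum wt (marked M)"
    and "\<And>i. i < n \<Longrightarrow> SW (M 5 0) < SW i \<Longrightarrow> i \<in> marked M"
  shows "runs record_best M (60 + n * 60) (\<lambda>M'.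
    ((M' 4 = M 4 \<and> M' 13 = M 13) \<or> (connected_safe_set (with_proj T) w (output_set n M') \<and>
      M' 13 0 = Suc (weight w (output_set n M')) \<and> (0 < M 13 0 \<longrightarrow> M' 13 0 \<le> M 13 0))) \<and>
    (SW (M 5 0) \<le> sum wt (marked M) \<longrightarrow> 0 < M' 13 0 \<and> M' 13 0 \<le> Suc (sum wt (marked M))))"
  (is "runs _ _ _ ?Q")
  unfolding record_best_def
proof (rule runs_Cond[where b = "20 + n * 60"])
  let ?p = "Conj (Neg (Less (reg 12) threshold))
      (Neg (Conj (Less (Num 0) (reg 13)) (Neg (Less (Add (reg 12) (Num 1)) (reg 13)))))"
  have p: "bval ?p M \<longleftrightarrow> SW (M 5 0) \<le> sum wt (marked M) \<and>
      (0 < M 13 0 \<longrightarrow> Suc (sum wt (marked M)) < M 13 0)"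
    using assms(2)[OF assms(3)] assms(5) by auto
  show "1 + btime ?p + (20 + n * 60) \<le> 60 + n * 60" by simp
  show "runs Skip M (20 + n * 60) ?Q" if "\<not> bval ?p M"
    using that unfolding p by (intro runs_straight) auto
  let ?c = "Assign 4 (Cell 7 (reg 17)) (Cell 11 (reg 17))"
  show "runs (Seq (Assign 13 (Num 0) (Add (reg 12) (Num 1))) (For 17 0 (reg 0) ?c)) M (20 + n * 60) ?Q"
    if b: "bval ?p M"
  proof (rule runs_Seq)
    let ?M = "M(13 := (M 13)(0 := Suc (sum wt (marked M))))"
    show "runs (Assign 13 (Num 0) (Add (reg 12) (Num 1))) M 6 (\<lambda>M'. M' = ?M)"
      by (rule runs_straight) (use assms(5) in auto)
    fix M' assume M': "M' = ?M"
    have "runs (For 17 0 (reg 0) ?c) M' (7 + atime (reg 0) + n * (40 + atime (reg 0) + 10))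
        (\<lambda>N. \<forall>j<n. N 4 (od j) = M 11 j)"
    proof (rule runs_For[where I = "\<lambda>i N. \<forall>j<i. N 4 (od j) = M 11 j"])
      fix i and N :: memory
      assume *: "i < n" "\<forall>j<i. N 4 (od j) = M 11 j" "N 17 0 = i"
        and fr: "same_outside (insert 17 (writes ?c)) M' N"
      have "env N" by (rule env_cong[OF assms(1)]) (use fr M' in auto)
      then have N: "N 7 = od" "N 11 = M 11" using fr M' by (auto simp: env_def)
      have "od j \<noteq> od i" if "j < i" for j using od_inj[of j i] that * by simp
      then show "runs ?c N 40 (\<lambda>N'. N' 17 0 = i \<and>
          (\<forall>j<Suc i. (N'(17 := (N' 17)(0 := Suc i))) 4 (od j) = M 11 j))"
        using * N by (intro runs_straight) (auto simp: less_Suc_eq)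
    qed (use assms(1) M' in \<open>auto simp: env_def\<close>)
    then show "runs (For 17 0 (reg 0) ?c) M' (9 + n * 60) ?Q"
    proof (rule runs_weaken)
      fix N assume N: "\<forall>j<n. N 4 (od j) = M 11 j"
        and fr: "same_outside (writes (For 17 0 (reg 0) ?c)) M' N"
      have N13: "N 13 0 = Suc (sum wt (marked M))" using fr M' by auto
      have out: "output_set n N = od ` marked M"
      proof (intro set_eqI iffI)
        fix v assume "v \<in> output_set n N"
        then have "v < n" "N 4 v \<noteq> 0" by (auto simp: output_set_def)
        then show "v \<in> od ` marked M" using od_surj[of v] N by (auto simp: marked_def)
      qed (use N od_less in \<open>auto simp: output_set_def marked_def\<close>)
      have "connected_safe_set (with_proj T) w (od ` marked M)"
      proof (rule connected_safe_setI[OF assms(4)])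
        fix i assume "i < n" "i \<notin> marked M"
        then have "SW i \<le> SW (M 5 0)" using assms(6)[of i] by linarith
        then show "SW i \<le> sum wt (marked M)" using b unfolding p by linarith
      qed
      moreover have "weight w (od ` marked M) = sum wt (marked M)"
        by (rule weight_od) (auto simp: marked_def)
      ultimately show "?Q N" using b unfolding p out N13 by auto
    qed simp
  qed simp
qed

lemma runs_try_tuple:
  assumes "env M" and "2 \<le> k" and "\<And>j. j < k \<Longrightarrow> M 5 j < n"
  shows "runs (try_tuple k) M (200 + k * 60 + n * 420) (\<lambda>M'.
    ((M' 4 = M 4 \<and> M' 13 = M 13) \<or> (connected_safe_set (with_proj T) w (output_set n M') \<and>
      M' 13 0 = Suc (weight w (output_set n M')) \<and> (0 < M 13 0 \<longrightarrow> M' 13 0 \<le> M 13 0))) \<and>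
    (\<forall>Z \<delta>. good k (M 5) Z \<delta> \<longrightarrow> 0 < M' 13 0 \<and> M' 13 0 \<le> Suc (sum wt Z + \<delta>)))"
  (is "runs _ _ _ ?Q")
  unfolding try_tuple_def
proof (rule runs_Seq[OF runs_load_weights[OF assms(1)]])
  fix M1 assume 1: "(\<forall>i<n. M1 10 i = wt i) \<and> marked M1 = {}" "same_outside (writes load_weights) M M1"
  have M1: "env M1" "M1 5 = M 5" "M1 4 = M 4" "M1 13 = M 13"
    using 1(2) assms(1) by (auto simp: load_weights_def intro: env_cong)
  show "runs (Seq (mark_tuple k) (Seq push_to_parents
    (Seq mark_heavy_subtrees (Seq add_light_vertices record_best)))) M1 (150 + k * 60 + n * 360) ?Q"
  proof (rule runs_Seq[OF runs_mark_tuple[OF M1(1)]])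
    fix M2 assume 2: "marked M2 = insert 0 (M1 5 ` {1..<k})" "same_outside (writes (mark_tuple k)) M1 M2"
    have M2: "env M2" "M2 5 = M 5" "M2 4 = M 4" "M2 13 = M 13" "\<And>i. i < n \<Longrightarrow> M2 10 i = wt i"
      using 1 2(2) M1 by (auto simp: mark_tuple_def intro: env_cong)
    show "runs (Seq push_to_parents (Seq mark_heavy_subtrees (Seq add_light_vertices record_best)))
      M2 (130 + n * 360) ?Q"
    proof (rule runs_Seq[OF runs_push_to_parents[OF M2(1,5) 2(1)]])
      fix M3 assume 3: "(\<forall>i<n. M3 10 i = SW i) \<and> least_closed (M1 5 ` {1..<k}) (marked M3)"
        "same_outside (writes push_to_parents) M2 M3"
      have M3: "env M3" "M3 5 = M 5" "M3 4 = M 4" "M3 13 = M 13" "\<And>i. i < n \<Longrightarrow> M3 10 i = SW i"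
        using 3 M2 by (auto simp: push_to_parents_def intro: env_cong)
      show "runs (Seq mark_heavy_subtrees (Seq add_light_vertices record_best)) M3 (110 + n * 260) ?Q"
      proof (rule runs_Seq[OF runs_mark_heavy_subtrees[OF M3(1,5)]])
        fix M4 assume 4: "marked M4 = marked M3 \<union> {i. i < n \<and> SW (M3 5 0) < SW i} \<and>
          M4 12 0 = sum wt (marked M3 \<union> {i. i < n \<and> SW (M3 5 0) < SW i})"
          "same_outside (writes mark_heavy_subtrees) M3 M4"
        have M4: "env M4" "M4 5 = M 5" "M4 4 = M 4" "M4 13 = M 13" "\<And>i. i < n \<Longrightarrow> M4 10 i = SW i"
          using 4(2) M3 by (auto simp: mark_heavy_subtrees_def intro: env_cong)
        show "runs (Seq add_light_vertices record_best) M4 (80 + n * 160) ?Q"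
        proof (rule runs_Seq[OF runs_add_light_vertices[where k = k and S\<^sub>0 = "marked M3", OF M4(1,5)]])
          fix M5 assume 5: "rooted_closed (marked M5) \<and> M5 12 0 = sum wt (marked M5) \<and>
             (\<forall>i<n. SW (M4 5 0) < SW i \<longrightarrow> i \<in> marked M5) \<and>
             (\<forall>Z \<delta>. good k (M4 5) Z \<delta> \<longrightarrow>
               SW (M4 5 0) \<le> sum wt (marked M5) \<and> sum wt (marked M5) \<le> sum wt Z + \<delta>)"
             "same_outside (writes add_light_vertices) M4 M5"
          have M5: "env M5" "M5 5 = M 5" "M5 4 = M 4" "M5 13 = M 13" "\<And>i. i < n \<Longrightarrow> M5 10 i = SW i"
            using 5(2) M4 by (auto simp: add_light_vertices_def intro: env_cong)
          have "runs record_best M5 (60 + n * 60) (\<lambda>M'.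
            ((M' 4 = M5 4 \<and> M' 13 = M5 13) \<or> (connected_safe_set (with_proj T) w (output_set n M') \<and>
              M' 13 0 = Suc (weight w (output_set n M')) \<and> (0 < M5 13 0 \<longrightarrow> M' 13 0 \<le> M5 13 0))) \<and>
            (SW (M5 5 0) \<le> sum wt (marked M5) \<longrightarrow> 0 < M' 13 0 \<and> M' 13 0 \<le> Suc (sum wt (marked M5))))"
            using 5(1) M5(2) M4(2) assms(2,3) by (intro runs_record_best M5) auto
          then show "runs record_best M5 (60 + n * 60) ?Q"
          proof (rule runs_weaken)
            fix M' assume H: "((M' 4 = M5 4 \<and> M' 13 = M5 13) \<or> (connected_safe_set (with_proj T) w (output_set n M') \<and>
              M' 13 0 = Suc (weight w (output_set n M')) \<and> (0 < M5 13 0 \<longrightarrow> M' 13 0 \<le> M5 13 0))) \<and>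
            (SW (M5 5 0) \<le> sum wt (marked M5) \<longrightarrow> 0 < M' 13 0 \<and> M' 13 0 \<le> Suc (sum wt (marked M5)))"
            have "0 < M' 13 0 \<and> M' 13 0 \<le> Suc (sum wt Z + \<delta>)" if "good k (M 5) Z \<delta>" for Z \<delta>
            proof -
              have "SW (M 5 0) \<le> sum wt (marked M5)" "sum wt (marked M5) \<le> sum wt Z + \<delta>"
                using 5(1) that unfolding M4(2) by blast+
              then show ?thesis using H M5(2) by auto
            qed
            then show "?Q M'" using H unfolding M5(3,4) by blast
          qed simp
        qed (use 3 4 M1 M3 M4 assms in auto)
      qed (use M3 assms in auto)
    qed simp_all
  qed (use 1 M1 assms in auto)
qed simp

end

subsection \<open>Rooting the tree\<close>

text \<open>The counter in array 9 is increased before it is stored in array 6, which gives the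
  position plus one and keeps 0 for unvisited vertices.\<close>

definition visit :: "aexp \<Rightarrow> aexp \<Rightarrow> com" where
  "visit u v = Seq (Assign 7 (reg 9) v) (Seq (Assign 8 (reg 9) (Sub (Cell 6 u) (Num 1)))
    (Seq (Assign 9 (Num 0) (Add (reg 9) (Num 1))) (Assign 6 v (reg 9))))"

abbreviation edge_fst :: aexp where "edge_fst \<equiv> Cell 2 (reg 16)"
abbreviation edge_snd :: aexp where "edge_snd \<equiv> Cell 3 (reg 16)"
abbreviation visited :: "aexp \<Rightarrow> bexp" where "visited u \<equiv> Less (Num 0) (Cell 6 u)"

definition scan_edge :: com where
  "scan_edge = Cond (Conj (visited edge_fst) (Neg (visited edge_snd))) (visit edge_fst edge_snd)
    (Cond (Conj (visited edge_snd) (Neg (visited edge_fst))) (visit edge_snd edge_fst) Skip)"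

text \<open>The edges come in any order, so the tree is grown by \<open>n\<close> sweeps over the
  whole list; each reaches a new vertex as long as one is left.\<close>

definition root_tree :: com where
  "root_tree = Seq (For 17 0 (reg 0) (Assign 6 (reg 17) (Num 0)))
    (Seq (Seq (Assign 7 (Num 0) (reg 14)) (Seq (Assign 6 (reg 14) (Num 1)) (Assign 9 (Num 0) (Num 1))))
      (For 15 0 (reg 0) (For 16 0 (Cell 0 (Num 1)) scan_edge)))"

text \<open>The fragment of \<open>rooted_tree\<close> that holds for the vertices reached so far,
  with array 6 inverting array 7 up to the shift by one.\<close>

definition grown :: "nat pair_pre_digraph \<Rightarrow> nat \<Rightarrow> nat \<Rightarrow> memory \<Rightarrow> bool" where
  "grown T n r M \<longleftrightarrow> 0 < M 9 0 \<and> M 7 0 = r \<and>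
    (\<forall>i<M 9 0. M 7 i < n \<and> M 6 (M 7 i) = Suc i) \<and>
    (\<forall>v<n. 0 < M 6 v \<longrightarrow> (\<exists>i<M 9 0. M 7 i = v)) \<and>
    (\<forall>i. 0 < i \<and> i < M 9 0 \<longrightarrow> M 8 i < i \<and> (M 7 i, M 7 (M 8 i)) \<in> parcs T)"

definition reached :: "nat \<Rightarrow> memory \<Rightarrow> nat set" where
  "reached n M = {v. v < n \<and> 0 < M 6 v}"

lemma finite_reached [simp]: "finite (reached n M)"
  by (simp add: reached_def)

lemma grown_bij:
  assumes "grown T n r M"
  shows "bij_betw (M 7) {..<M 9 0} (reached n M)"
  unfolding bij_betw_def
proof
  show "inj_on (M 7) {..<M 9 0}"
    using assms unfolding inj_on_def grown_def by (metis lessThan_iff nat.inject)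
  show "M 7 ` {..<M 9 0} = reached n M"
    using assms unfolding grown_def reached_def by fastforce
qed

lemma grown_card: "grown T n r M \<Longrightarrow> card (reached n M) = M 9 0"
  using bij_betw_same_card[OF grown_bij] by fastforce

lemma grown_le: "grown T n r M \<Longrightarrow> M 9 0 \<le> n"
  using grown_card[of T n r M] card_mono[of "{..<n}" "reached n M"] by (auto simp: reached_def)

lemma grown_cong:
  "grown T n r M \<Longrightarrow> M' 6 = M 6 \<Longrightarrow> M' 7 = M 7 \<Longrightarrow> M' 8 = M 8 \<Longrightarrow> M' 9 = M 9 \<Longrightarrow> grown T n r M'"
  by (simp add: grown_def)

text \<open>\<open>visit\<close> evaluates its arguments again after writing to arrays 7 to 9; hence
  the assumption that their values are determined by arrays 2, 3 and 16.\<close>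

lemma result_visit:
  assumes "grown T n r M"
    and u: "\<And>N. N 2 = M 2 \<Longrightarrow> N 3 = M 3 \<Longrightarrow> N 16 = M 16 \<Longrightarrow> aval u N = a"
    and v: "\<And>N. N 2 = M 2 \<Longrightarrow> N 3 = M 3 \<Longrightarrow> N 16 = M 16 \<Longrightarrow> aval v N = b"
    and "a < n" "b < n" and "0 < M 6 a" "M 6 b = 0" "(b, a) \<in> parcs T"
  shows "grown T n r (result (visit u v) M)" and "reached n (result (visit u v) M) = insert b (reached n M)"
proof -
  let ?R = "result (visit u v) M"
  let ?c = "M 9 0"
  have R: "?R 6 = (M 6)(b := Suc ?c)" "?R 7 = (M 7)(?c := b)" "?R 8 = (M 8)(?c := M 6 a - 1)"
    "?R 9 0 = Suc ?c"
    using u v by (simp_all add: visit_def)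
  obtain i where i: "i < ?c" "M 7 i = a" "M 6 a = Suc i"
    using assms(1,4,6) unfolding grown_def by metis
  have b: "M 7 j \<noteq> b" if "j < ?c" for j
    using assms(1,7) that unfolding grown_def by (metis nat.distinct(1))
  show "grown T n r ?R"
    unfolding grown_def R
  proof (intro conjI allI impI)
    show "((M 7)(?c := b)) 0 = r" using assms(1) by (auto simp: grown_def)
    fix j assume j: "j < Suc ?c"
    show "((M 7)(?c := b)) j < n" using j assms(1,5) by (auto simp: grown_def less_Suc_eq)
    show "((M 6)(b := Suc ?c)) (((M 7)(?c := b)) j) = Suc j"
      using j assms(1) b by (auto simp: grown_def less_Suc_eq)
  next
    fix v' assume "v' < n" "0 < ((M 6)(b := Suc ?c)) v'"
    then show "\<exists>i<Suc ?c. ((M 7)(?c := b)) i = v'"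
    proof (cases "v' = b")
      case False
      then obtain j where "j < ?c" "M 7 j = v'"
        using \<open>v' < n\<close> \<open>0 < ((M 6)(b := Suc ?c)) v'\<close> assms(1) unfolding grown_def
        by (metis fun_upd_other)
      then show ?thesis by (intro exI[of _ j]) simp
    qed (intro exI[of _ ?c], simp)
  next
    fix j assume j: "0 < j \<and> j < Suc ?c"
    have *: "M 8 j < j" "(M 7 j, M 7 (M 8 j)) \<in> parcs T" if "j \<noteq> ?c"
      using that j assms(1) unfolding grown_def by (simp_all add: less_Suc_eq)
    show "((M 8)(?c := M 6 a - 1)) j < j" using j i * by (cases "j = ?c") auto
    show "(((M 7)(?c := b)) j, ((M 7)(?c := b)) (((M 8)(?c := M 6 a - 1)) j)) \<in> parcs T"
    proof (cases "j = ?c")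
      case True then show ?thesis using i assms(8) by simp
    next
      case False
      then have "M 8 j \<noteq> ?c" using * j by auto
      then show ?thesis using * False by simp
    qed
  qed simp
  show "reached n ?R = insert b (reached n M)"
    using assms(5) unfolding reached_def R by auto
qed

lemma runs_scan_edge:
  assumes "grown T n r M" and "a = M 2 (M 16 0)" "b = M 3 (M 16 0)" and "a < n" "b < n"
    and "(a, b) \<in> parcs T" "(b, a) \<in> parcs T"
  shows "runs scan_edge M 120 (\<lambda>M'. grown T n r M' \<and> reached n M \<subseteq> reached n M' \<and>
    (a \<in> reached n M \<or> b \<in> reached n M \<longrightarrow> a \<in> reached n M' \<and> b \<in> reached n M'))"
proof (rule runs_straight)
  show "loop_free scan_edge" by (simp add: scan_edge_def visit_def)
  show "duration scan_edge \<le> 120" by (simp add: scan_edge_def visit_def)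
  consider (fst) "0 < M 6 a" "M 6 b = 0" | (snd) "0 < M 6 b" "M 6 a = 0"
    | (none) "M 6 a = 0 \<longleftrightarrow> M 6 b = 0" by (metis gr0I)
  then show "grown T n r (result scan_edge M) \<and> reached n M \<subseteq> reached n (result scan_edge M) \<and>
    (a \<in> reached n M \<or> b \<in> reached n M \<longrightarrow>
      a \<in> reached n (result scan_edge M) \<and> b \<in> reached n (result scan_edge M))"
  proof cases
    case fst
    then have "result scan_edge M = result (visit edge_fst edge_snd) M"
      using assms(2,3) by (simp add: scan_edge_def)
    then show ?thesis
      using result_visit[of T n r M edge_fst a edge_snd b] assms fst by (auto simp: reached_def)
  next
    case snd
    then have "result scan_edge M = result (visit edge_snd edge_fst) M"
      using assms(2,3) by (simp add: scan_edge_def)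
    then show ?thesis
      using result_visit[of T n r M edge_snd b edge_fst a] assms snd by (auto simp: reached_def)
  next
    case none
    then have "result scan_edge M = M" using assms(2,3) by (auto simp: scan_edge_def)
    then show ?thesis using none assms by (auto simp: reached_def)
  qed
qed

lemma writes_scan_edge: "writes scan_edge = {6, 7, 8, 9}"
  by (auto simp: scan_edge_def visit_def)

text \<open>A nonempty set closed under arcs would absorb all vertices by connectedness.\<close>

lemma crossing_arc:
  assumes "undirected_tree T" and "A \<subset> pverts T" and "A \<noteq> {}"
  obtains u v where "u \<in> A" "v \<in> pverts T - A" "(u, v) \<in> parcs T"
proof -
  interpret pair_graph T using assms(1) by (simp add: undirected_tree_def)
  obtain u v where uv: "u \<in> A" "v \<in> pverts T - A" using assms(2,3) by auto
  have "(parcs T)\<^sup>s = parcs T" using graph_symmetric by (auto simp: symcl_def)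
  then have "(u, v) \<in> rtrancl_on (pverts T) (parcs T)"
    using assms(1,2) uv by (auto simp: undirected_tree_def connected_conv)
  then have "v \<in> A" if "\<And>x y. x \<in> A \<Longrightarrow> (x, y) \<in> parcs T \<Longrightarrow> y \<in> A"
    by (induct rule: rtrancl_on_induct) (use uv(1) that in auto)
  then obtain x y where xy: "x \<in> A" "(x, y) \<in> parcs T" "y \<notin> A" using uv by blast
  show thesis by (rule that[of x y]) (use xy wellformed'(2) in auto)
qed

definition stores_graph :: "nat \<Rightarrow> (nat \<times> nat) list \<Rightarrow> (nat \<Rightarrow> nat) \<Rightarrow> memory \<Rightarrow> bool" where
  "stores_graph n es w M \<longleftrightarrow> M 0 0 = n \<and> M 0 1 = length es \<and> (\<forall>v<n. M 1 v = w v) \<and>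
    (\<forall>i<length es. M 2 i = fst (es ! i) \<and> M 3 i = snd (es ! i))"

lemma stores_graph_cong:
  "stores_graph n es w M \<Longrightarrow> M' 0 = M 0 \<Longrightarrow> M' 1 = M 1 \<Longrightarrow> M' 2 = M 2 \<Longrightarrow> M' 3 = M 3 \<Longrightarrow>
    stores_graph n es w M'"
  by (simp add: stores_graph_def)

text \<open>By \<open>crossing_arc\<close> some edge joins the set reached before the sweep to a
  vertex outside it. Wherever this edge stands in the list and however it is oriented, scanning it
  leaves that vertex reached.\<close>

lemma runs_scan_edges:
  assumes T: "undirected_tree T" "pverts T = {..<n}" "edge_list T es"
    and M: "stores_graph n es w M" "grown T n r M"
  shows "runs (For 16 0 (Cell 0 (Num 1)) scan_edge) M (9 + length es * 132)
    (\<lambda>M'. grown T n r M' \<and> (M 9 0 < M' 9 0 \<or> M' 9 0 = n))"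
proof -
  interpret pair_graph T using T(1) by (simp add: undirected_tree_def)
  define I where "I i N \<longleftrightarrow> grown T n r N \<and> reached n M \<subseteq> reached n N \<and>
    (\<forall>j<i. fst (es ! j) \<in> reached n M \<or> snd (es ! j) \<in> reached n M \<longrightarrow>
      fst (es ! j) \<in> reached n N \<and> snd (es ! j) \<in> reached n N)" for i N
  have "runs (For 16 0 (Cell 0 (Num 1)) scan_edge) M
    (7 + atime (Cell 0 (Num 1)) + length es * (120 + atime (Cell 0 (Num 1)) + 10)) (I (length es))"
  proof (rule runs_For)
    have "reached n (M(16 := f)) = reached n M" for f by (simp add: reached_def)
    moreover have "grown T n r (M(16 := f))" for f by (rule grown_cong[OF M(2)]) auto
    ultimately show "I 0 (M(16 := (M 16)(0 := 0)))" by (simp add: I_def)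
    show "aval (Cell 0 (Num 1)) N = length es" if "same_outside (insert 16 (writes scan_edge)) M N" for N
      using that M(1) by (simp add: stores_graph_def writes_scan_edge)
    fix i and N :: memory
    assume *: "i < length es" "I i N" "N 16 0 = i" and fr: "same_outside (insert 16 (writes scan_edge)) M N"
    have "stores_graph n es w N"
      by (rule stores_graph_cong[OF M(1)]) (use fr in \<open>auto simp: writes_scan_edge\<close>)
    then have e: "N 2 (N 16 0) = fst (es ! i)" "N 3 (N 16 0) = snd (es ! i)"
      using * by (auto simp: stores_graph_def)
    have "es ! i \<in> set es" using * by simp
    then have "(fst (es ! i), snd (es ! i)) \<in> parcs T" "(snd (es ! i), fst (es ! i)) \<in> parcs T"
      using T(3) by (auto simp: edge_list_def)
    moreover from this have "fst (es ! i) < n" "snd (es ! i) < n"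
      using wellformed' T(2) by auto
    ultimately have "runs scan_edge N 120 (\<lambda>N'. grown T n r N' \<and> reached n N \<subseteq> reached n N' \<and>
      (fst (es ! i) \<in> reached n N \<or> snd (es ! i) \<in> reached n N \<longrightarrow>
        fst (es ! i) \<in> reached n N' \<and> snd (es ! i) \<in> reached n N'))"
      using * e by (intro runs_scan_edge) (auto simp: I_def)
    then show "runs scan_edge N 120 (\<lambda>N'. N' 16 0 = i \<and> I (Suc i) (N'(16 := (N' 16)(0 := Suc i))))"
    proof (rule runs_weaken)
      fix N' assume N': "grown T n r N' \<and> reached n N \<subseteq> reached n N' \<and>
      (fst (es ! i) \<in> reached n N \<or> snd (es ! i) \<in> reached n N \<longrightarrow>
        fst (es ! i) \<in> reached n N' \<and> snd (es ! i) \<in> reached n N')"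
        and fr': "same_outside (writes scan_edge) N N'"
      have "reached n (N'(16 := f)) = reached n N'" for f by (simp add: reached_def)
      moreover have "grown T n r (N'(16 := f))" for f
        using grown_cong[of T n r N' "N'(16 := f)"] N' by simp
      moreover have "N' 16 0 = i" using fr' * by (simp add: writes_scan_edge)
      ultimately show "N' 16 0 = i \<and> I (Suc i) (N'(16 := (N' 16)(0 := Suc i)))"
        using N' *(2) unfolding I_def less_Suc_eq by blast
    qed simp
  qed
  moreover have "grown T n r N \<and> (M 9 0 < N 9 0 \<or> N 9 0 = n)" if "I (length es) N" for N
  proof
    show g: "grown T n r N" using that by (simp add: I_def)
    have sub: "reached n M \<subseteq> reached n N" using that by (simp add: I_def)
    show "M 9 0 < N 9 0 \<or> N 9 0 = n"
    proof (cases "reached n M = {..<n}")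
      case True
      then have "reached n N = {..<n}" using sub by (auto simp: reached_def)
      then show ?thesis using grown_card[OF g] by simp
    next
      case False
      then have "reached n M \<subset> pverts T" using T(2) by (auto simp: reached_def)
      moreover have "reached n M \<noteq> {}" using grown_card[OF M(2)] M(2) by (auto simp: grown_def)
      ultimately obtain u v where uv: "u \<in> reached n M" "v \<in> pverts T - reached n M" "(u, v) \<in> parcs T"
        using crossing_arc[OF T(1)] by blast
      have "(u, v) \<in> set es \<or> (v, u) \<in> set es" using T(3) uv(3) unfolding edge_list_def by blast
      then obtain j where "j < length es" "es ! j = (u, v) \<or> es ! j = (v, u)"
        by (metis in_set_conv_nth)
      then have "v \<in> reached n N" using that uv(1) unfolding I_def by fastforce
      then have "reached n M \<subset> reached n N" using sub uv by auto
      then have "card (reached n M) < card (reached n N)" by (intro psubset_card_mono) auto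
      then show ?thesis using grown_card[OF g] grown_card[OF M(2)] by simp
    qed
  qed
  ultimately show ?thesis by (elim runs_weaken) auto
qed

lemma runs_root_tree:
  assumes T: "undirected_tree T" "pverts T = {..<n}" "edge_list T es"
    and M: "stores_graph n es w M" "M 14 0 < n"
  shows "runs root_tree M (40 + n * (100 + length es * 132))
    (\<lambda>M'. rooted_tree T n (M' 7) (M' 8) \<and> M' 7 0 = M 14 0)"
  unfolding root_tree_def
proof (rule runs_Seq)
  let ?c = "Assign 6 (reg 17) (Num 0)"
  show "runs (For 17 0 (reg 0) ?c) M (7 + atime (reg 0) + n * (10 + atime (reg 0) + 10)) (\<lambda>M'. \<forall>v<n. M' 6 v = 0)"
    by (rule runs_For[where I = "\<lambda>i N. \<forall>v<i. N 6 v = 0"])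
      (use M(1) in \<open>auto simp: stores_graph_def less_Suc_eq intro!: runs_straight\<close>)
  fix M1 assume 1: "\<forall>v<n. M1 6 v = 0" "same_outside (writes (For 17 0 (reg 0) ?c)) M M1"
  let ?i = "Seq (Assign 7 (Num 0) (reg 14)) (Seq (Assign 6 (reg 14) (Num 1)) (Assign 9 (Num 0) (Num 1)))"
  show "runs (Seq ?i (For 15 0 (reg 0) (For 16 0 (Cell 0 (Num 1)) scan_edge))) M1
    (20 + (9 + n * (21 + length es * 132))) (\<lambda>M'. rooted_tree T n (M' 7) (M' 8) \<and> M' 7 0 = M 14 0)"
  proof (rule runs_Seq)
    have "M1 14 0 = M 14 0" using 1(2) by simp
    then show "runs ?i M1 20 (\<lambda>N. grown T n (M 14 0) N \<and> N 9 0 = 1)"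
      using 1(1) M(2) by (intro runs_straight) (auto simp: grown_def)
    fix M2 assume 2: "grown T n (M 14 0) M2 \<and> M2 9 0 = 1" "same_outside (writes ?i) M1 M2"
    have M2: "stores_graph n es w M2"
      by (rule stores_graph_cong[OF M(1)]) (use 1(2) 2(2) in auto)
    let ?d = "For 16 0 (Cell 0 (Num 1)) scan_edge"
    have "runs (For 15 0 (reg 0) ?d) M2 (7 + atime (reg 0) + n * ((9 + length es * 132) + atime (reg 0) + 10))
      (\<lambda>N. grown T n (M 14 0) N \<and> (n < N 9 0 \<or> N 9 0 = n))"
    \<comment> \<open>The root is reached at the start, so after \<open>i\<close> sweeps more than
      \<open>i\<close> vertices are, or all. After \<open>n\<close> sweeps \<open>grown_le\<close>
      leaves only the second case.\<close>
    proof (rule runs_For[where I = "\<lambda>i N. grown T n (M 14 0) N \<and> (i < N 9 0 \<or> N 9 0 = n)"])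
      show "grown T n (M 14 0) (M2(15 := (M2 15)(0 := 0))) \<and>
          (0 < (M2(15 := (M2 15)(0 := 0))) 9 0 \<or> (M2(15 := (M2 15)(0 := 0))) 9 0 = n)"
        using 2(1) by (auto intro: grown_cong)
      show "aval (reg 0) N = n" if "same_outside (insert 15 (writes ?d)) M2 N" for N
        using that M2 by (auto simp: writes_scan_edge stores_graph_def)
      fix i N assume *: "i < n" "grown T n (M 14 0) N \<and> (i < N 9 0 \<or> N 9 0 = n)" "N 15 0 = i"
        and fr: "same_outside (insert 15 (writes ?d)) M2 N"
      have N: "stores_graph n es w N"
        by (rule stores_graph_cong[OF M2]) (use fr in \<open>auto simp: writes_scan_edge\<close>)
      show "runs ?d N (9 + length es * 132) (\<lambda>N'. N' 15 0 = i \<and>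
          grown T n (M 14 0) (N'(15 := (N' 15)(0 := Suc i))) \<and>
          (Suc i < (N'(15 := (N' 15)(0 := Suc i))) 9 0 \<or> (N'(15 := (N' 15)(0 := Suc i))) 9 0 = n))"
      proof (rule runs_weaken[OF runs_scan_edges[OF T N conjunct1[OF *(2)]]])
        fix N' assume N': "grown T n (M 14 0) N' \<and> (N 9 0 < N' 9 0 \<or> N' 9 0 = n)"
          and fr': "same_outside (writes ?d) N N'"
        have "N' 15 0 = i" using fr' * by (auto simp: writes_scan_edge)
        moreover have "grown T n (M 14 0) (N'(15 := f))" for f
          using grown_cong[of T n "M 14 0" N' "N'(15 := f)"] N' by simp
        moreover have "Suc i < N' 9 0 \<or> N' 9 0 = n" using N' * grown_le[of T n "M 14 0" N'] by auto
        ultimately show "N' 15 0 = i \<and>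
          grown T n (M 14 0) (N'(15 := (N' 15)(0 := Suc i))) \<and>
          (Suc i < (N'(15 := (N' 15)(0 := Suc i))) 9 0 \<or> (N'(15 := (N' 15)(0 := Suc i))) 9 0 = n)"
          by simp
      qed simp
    qed
    then show "runs (For 15 0 (reg 0) ?d) M2 (9 + n * (21 + length es * 132))
      (\<lambda>M'. rooted_tree T n (M' 7) (M' 8) \<and> M' 7 0 = M 14 0)"
    proof (rule runs_weaken)
      fix N assume N: "grown T n (M 14 0) N \<and> (n < N 9 0 \<or> N 9 0 = n)"
      then have c: "N 9 0 = n" using grown_le[of T n "M 14 0" N] by auto
      then have "reached n N = {..<n}"
        using grown_card[of T n "M 14 0" N] N by (intro card_subset_eq) (auto simp: reached_def)
      then have "bij_betw (N 7) {..<n} {..<n}" using grown_bij[of T n "M 14 0" N] N c by simp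
      moreover have "0 < i \<Longrightarrow> i < n \<Longrightarrow> N 8 i < i" "0 < i \<Longrightarrow> i < n \<Longrightarrow> (N 7 i, N 7 (N 8 i)) \<in> parcs T" for i
        using N c by (auto simp: grown_def)
      ultimately have "rooted_tree T n (N 7) (N 8)" using T by unfold_locales auto
      then show "rooted_tree T n (N 7) (N 8) \<and> N 7 0 = M 14 0" using N by (simp add: grown_def)
    qed simp
  qed simp
qed (simp add: algebra_simps)

subsection \<open>Enumerating tuples\<close>

text \<open>The loop counters are the tuple itself: level \<open>j\<close> counts in cell
  \<open>j\<close> of array 5. The depth is part of the program text, and this is where
  \<open>\<epsilon>\<close> enters.\<close>

primrec nest :: "nat \<Rightarrow> com \<Rightarrow> com" where
  "nest 0 c = c"
| "nest (Suc j) c = For 5 j (reg 0) (nest j c)"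

lemma writes_nest: "writes (nest j c) \<subseteq> insert 5 (writes c)"
  by (induction j) auto

primrec nest_time :: "nat \<Rightarrow> nat \<Rightarrow> nat \<Rightarrow> nat" where
  "nest_time n b 0 = b"
| "nest_time n b (Suc j) = 9 + n * (nest_time n b j + 12)"

text \<open>The constant 21 comes from the overhead of one level,
  \<open>9 + 12 * n \<le> 21 * n ^ Suc j\<close>.\<close>

lemma nest_time_le:
  assumes "0 < n"
  shows "nest_time n b j \<le> n ^ j * (b + 21 * j)"
proof (induction j)
  case (Suc j)
  have "1 \<le> n ^ Suc j" "n \<le> n ^ Suc j" using assms by (auto simp: Suc_le_eq)
  have "nest_time n b (Suc j) \<le> 9 + n * (n ^ j * (b + 21 * j) + 12)" using Suc by simp
  also have "\<dots> = n ^ Suc j * (b + 21 * j) + 9 + 12 * n" by (simp add: algebra_simps)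
  also have "\<dots> \<le> n ^ Suc j * (b + 21 * j) + 9 * n ^ Suc j + 12 * n ^ Suc j"
    using \<open>1 \<le> n ^ Suc j\<close> \<open>n \<le> n ^ Suc j\<close> by linarith
  also have "\<dots> = n ^ Suc j * (b + 21 * Suc j)" by (simp add: algebra_simps)
  finally show ?case .
qed simp

text \<open>\<open>G\<close> is a success that is never lost, and the loops reach it because they
  pass through the tuple \<open>x\<close>. The proposition \<open>h\<close> covers runs for which no
  such tuple is available; in the application it says that the current root is the right
  one.\<close>

lemma runs_nest:
  assumes I_n: "\<And>M. I M \<Longrightarrow> M 0 0 = n" and "0 \<notin> writes c" "5 \<notin> writes c"
    and I5: "\<And>M f. I M \<Longrightarrow> I (M(5 := f))" and G5: "\<And>M f. G M \<Longrightarrow> G (M(5 := f))"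
    and body: "\<And>M. I M \<Longrightarrow> \<forall>j<k. M 5 j < n \<Longrightarrow> runs c M b (\<lambda>M'. I M' \<and> (G M \<longrightarrow> G M') \<and>
      (h \<and> (\<forall>j<k. M 5 j = x j) \<longrightarrow> G M'))"
    and x: "\<And>j. h \<Longrightarrow> j < k \<Longrightarrow> x j < n"
  shows "j \<le> k \<Longrightarrow> I M \<Longrightarrow> \<forall>i. j \<le> i \<and> i < k \<longrightarrow> M 5 i < n \<Longrightarrow>
    runs (nest j c) M (nest_time n b j) (\<lambda>M'. I M' \<and> (G M \<longrightarrow> G M') \<and>
      (h \<and> (\<forall>i. j \<le> i \<and> i < k \<longrightarrow> M 5 i = x i) \<longrightarrow> G M') \<and> (\<forall>i\<ge>j. M' 5 i = M 5 i))"
proof (induction j arbitrary: M)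
  case 0
  show ?case
    using runs_weaken[OF body[OF 0(2)] order_refl] 0(3) assms(3) by simp
next
  case (Suc j)
  let ?h = "h \<and> (\<forall>i. Suc j \<le> i \<and> i < k \<longrightarrow> M 5 i = x i)"
  \<comment> \<open>Once counter \<open>j\<close> has passed \<open>x j\<close>, success is secured,
    provided the outer entries agree with \<open>x\<close>.\<close>
  define J where "J i N \<longleftrightarrow> I N \<and> (G M \<longrightarrow> G N) \<and> (?h \<and> x j < i \<longrightarrow> G N) \<and>
    (\<forall>i\<ge>Suc j. N 5 i = M 5 i)" for i and N :: memory
  have "runs (For 5 j (reg 0) (nest j c)) M (7 + atime (reg 0) + n * (nest_time n b j + atime (reg 0) + 10)) (J n)"
  proof (rule runs_For)
    show "J 0 (M(5 := (M 5)(j := 0)))" using Suc.prems I5 G5 by (auto simp: J_def)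
    show "aval (reg 0) N = n" if "same_outside (insert 5 (writes (nest j c))) M N" for N
    proof -
      have "0 \<notin> insert 5 (writes (nest j c))" using writes_nest[of j c] assms(2) by auto
      then show ?thesis using that I_n[OF Suc.prems(2)] by simp
    qed
    fix i and N :: memory assume *: "i < n" "J i N" "N 5 j = i"
    have "\<forall>i. j \<le> i \<and> i < k \<longrightarrow> N 5 i < n"
    proof (intro allI impI)
      fix l assume l: "j \<le> l \<and> l < k"
      show "N 5 l < n"
      proof (cases "l = j")
        case False
        then have "Suc j \<le> l" using l by simp
        then show ?thesis using * Suc.prems(3) l by (simp add: J_def)
      qed (use * in simp)
    qed
    then have "runs (nest j c) N (nest_time n b j) (\<lambda>N'. I N' \<and> (G N \<longrightarrow> G N') \<and>
      (h \<and> (\<forall>i. j \<le> i \<and> i < k \<longrightarrow> N 5 i = x i) \<longrightarrow> G N') \<and> (\<forall>i\<ge>j. N' 5 i = N 5 i))"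
      using * Suc.prems(1) by (intro Suc.IH) (auto simp: J_def)
    then show "runs (nest j c) N (nest_time n b j)
        (\<lambda>N'. N' 5 j = i \<and> J (Suc i) (N'(5 := (N' 5)(j := Suc i))))"
    proof (rule runs_weaken)
      fix N' assume N': "I N' \<and> (G N \<longrightarrow> G N') \<and>
        (h \<and> (\<forall>i. j \<le> i \<and> i < k \<longrightarrow> N 5 i = x i) \<longrightarrow> G N') \<and> (\<forall>i\<ge>j. N' 5 i = N 5 i)"
      have "G N'" if "?h" "x j < Suc i"
      proof (cases "x j < i")
        case True then show ?thesis using * N' that by (simp add: J_def)
      next
        case False
        then have "x j = i" using that by simp
        moreover have "N 5 l = x l" if "j \<le> l" "l < k" for l
          using that * \<open>?h\<close> \<open>x j = i\<close> by (cases "l = j") (auto simp: J_def)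
        ultimately show ?thesis using N' that(1) by blast
      qed
      then have "J (Suc i) (N'(5 := (N' 5)(j := Suc i)))"
        using N' *(2) I5 G5 by (simp add: J_def)
      then show "N' 5 j = i \<and> J (Suc i) (N'(5 := (N' 5)(j := Suc i)))" using N' * by simp
    qed simp
  qed
  then have "runs (nest (Suc j) c) M (9 + n * (nest_time n b j + 12)) (J n)" by (simp add: add_ac)
  then show ?case
    by (rule runs_weaken) (use x Suc.prems(1) in \<open>auto simp: J_def\<close>)
qed

subsection \<open>The approximation algorithm\<close>

lemma finite_maximizer:
  fixes f :: "'a \<Rightarrow> nat"
  assumes "finite A" "A \<noteq> {}"
  obtains m where "m \<in> A" "\<And>i. i \<in> A \<Longrightarrow> f i \<le> f m"
proof -
  have "Max (f ` A) \<in> f ` A" using assms by (intro Max_in) auto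
  then obtain m where "m \<in> A" "f m = Max (f ` A)" by auto
  then show thesis using that[of m] assms(1) by simp
qed

context rooted_tree begin

text \<open>Here \<open>\<delta>\<close> is arbitrary; the vertices of \<open>U\<close> heavier than
  \<open>\<delta>\<close> only have to fit into \<open>k - 2\<close> entries.\<close>

lemma good_tuple_exists:
  assumes U: "connected_safe_set (with_proj T) w U" and root: "od 0 \<in> U"
    and k: "2 + card {v \<in> U. \<delta> < w v} \<le> k"
  obtains x Z where "good k x Z \<delta>" "sum wt Z = weight w U" "\<And>j. j < k \<Longrightarrow> x j < n"
proof -
  define Z where "Z = {i. i < n \<and> od i \<in> U}"
  have Z: "rooted_closed Z" "sum wt Z = weight w U" "\<And>i. i < n \<Longrightarrow> i \<notin> Z \<Longrightarrow> SW i \<le> weight w U"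
    using connected_safe_setD[OF U root] by (auto simp: Z_def)
  have Zn: "Z \<subseteq> {..<n}" and "0 \<in> Z" using Z(1) by (auto simp: rooted_closed_def)
  then have "finite Z" using finite_subset by blast
  \<comment> \<open>The root of a heaviest missing subtree. If nothing is missing, the root of the
    tree serves, because its subtree weighs no more than \<open>Z\<close>.\<close>
  obtain m where m: "m < n" "SW m \<le> sum wt Z" "\<forall>i<n. SW m < SW i \<longrightarrow> i \<in> Z"
  proof (cases "Z = {..<n}")
    case True
    have "SW 0 \<le> sum wt Z" unfolding SW_def True by (rule sum_mono2) (use subtree_less in auto)
    then show thesis using n_pos True by (intro that[of 0]) auto
  next
    case False
    then have ne: "finite ({..<n} - Z)" "{..<n} - Z \<noteq> {}" using Zn by auto
    obtain m where m: "m \<in> {..<n} - Z" "\<And>i. i \<in> {..<n} - Z \<Longrightarrow> SW i \<le> SW m"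
      using finite_maximizer[OF ne] by blast
    show thesis
    proof (rule that)
      show "m < n" "SW m \<le> sum wt Z" using m(1) Z(2,3) by auto
      show "\<forall>i<n. SW m < SW i \<longrightarrow> i \<in> Z" using m(2) by (force simp: not_le[symmetric])
    qed
  qed
  define H where "H = {i \<in> Z. \<delta> < wt i}"
  have "finite H" using \<open>finite Z\<close> by (simp add: H_def)
  have "od ` H \<subseteq> {v \<in> U. \<delta> < w v}" by (auto simp: H_def Z_def wt_def)
  moreover have "inj_on od H" using od_bij Zn by (auto simp: bij_betw_def H_def intro: inj_on_subset)
  moreover have "finite {v \<in> U. \<delta> < w v}"
    by (rule finite_subset[of _ "{..<n}"])
      (use U verts in \<open>auto simp: connected_safe_set_def safe_set_def\<close>)
  ultimately have "card H \<le> card {v \<in> U. \<delta> < w v}" by (metis card_image card_mono)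
  then have card_H: "2 + card H \<le> k" using k by simp
  \<comment> \<open>A heaviest light member of \<open>Z\<close>. If there is none, the root is a
    placeholder and \<open>Z \<subseteq> H\<close> holds instead.\<close>
  obtain u where u: "u \<in> Z" "\<forall>i\<in>Z - H. wt i \<le> wt u" "Z \<subseteq> H \<or> wt u \<le> \<delta>"
  proof (cases "Z - H = {}")
    case True then show thesis using \<open>0 \<in> Z\<close> by (intro that[of 0]) auto
  next
    case False
    have fin: "finite (Z - H)" using \<open>finite Z\<close> by simp
    obtain u where u: "u \<in> Z - H" "\<And>i. i \<in> Z - H \<Longrightarrow> wt i \<le> wt u"
      using finite_maximizer[OF fin False] by blast
    then show thesis by (intro that[of u]) (auto simp: H_def)
  qed
  obtain hs where hs: "set hs = H" "length hs = card H"
    using finite_distinct_list[OF \<open>finite H\<close>] distinct_card by metis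
  \<comment> \<open>Heavy vertices occupy the entries from 2 on; padding with \<open>u\<close> makes
    the length independent of their number.\<close>
  define x where "x j = (if j = 0 then m else if j = 1 then u else if j - 2 < length hs then hs ! (j - 2) else u)"
    for j
  have img: "x ` {1..<k} = insert u H"
  proof (intro set_eqI iffI)
    fix i assume "i \<in> insert u H"
    then show "i \<in> x ` {1..<k}"
    proof
      assume "i = u" then show ?thesis using card_H by (intro image_eqI[of _ _ 1]) (auto simp: x_def)
    next
      assume "i \<in> H"
      then obtain j where "j < length hs" "hs ! j = i" using hs(1) by (metis in_set_conv_nth)
      then show ?thesis using card_H hs(2) by (intro image_eqI[of _ _ "j + 2"]) (auto simp: x_def)
    qed
  qed (use hs(1) in \<open>auto simp: x_def\<close>)
  have "H \<subseteq> Z" by (auto simp: H_def)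
  have x01: "x 0 = m" "x 1 = u" by (auto simp: x_def)
  have "good k x Z \<delta>" unfolding good_def img x01
    using Z(1) u m \<open>H \<subseteq> Z\<close> by auto
  moreover have "x j < n" if "j < k" for j
  proof (cases "j = 0")
    case False
    then have "x j \<in> x ` {1..<k}" using that by auto
    then show ?thesis using img u \<open>H \<subseteq> Z\<close> Zn by auto
  qed (use m x01 in simp)
  ultimately show thesis using that Z(2) by blast
qed

end

definition safe_set_search :: "nat \<Rightarrow> com" where
  "safe_set_search k = For 14 0 (reg 0) (Seq root_tree (nest k (try_tuple k)))"

definition valid_best :: "nat pair_pre_digraph \<Rightarrow> nat \<Rightarrow> (nat \<Rightarrow> nat) \<Rightarrow> memory \<Rightarrow> bool" where
  "valid_best T n w M \<longleftrightarrow> (0 < M 13 0 \<longrightarrow> connected_safe_set (with_proj T) w (output_set n M) \<and>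
    M 13 0 = Suc (weight w (output_set n M)))"

lemma valid_best_cong:
  "valid_best T n w M \<Longrightarrow> M' 4 = M 4 \<Longrightarrow> M' 13 = M 13 \<Longrightarrow> valid_best T n w M'"
  by (simp add: valid_best_def output_set_def)

lemma writes_root_tree: "writes root_tree = {6, 7, 8, 9, 15, 16, 17}"
  by (auto simp: root_tree_def writes_scan_edge)

lemma writes_try_tuple: "writes (try_tuple k) = {4, 10, 11, 12, 13, 17}"
  by (auto simp: try_tuple_def load_weights_def mark_tuple_def push_to_parents_def
      mark_heavy_subtrees_def add_light_vertices_def record_best_def)

definition total_time :: "nat \<Rightarrow> nat \<Rightarrow> nat \<Rightarrow> nat" where
  "total_time n m k = 9 + n * (40 + n * (100 + m * 132) + nest_time n (200 + k * 60 + n * 420) k + 12)"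

text \<open>Each iteration keeps the record valid. The bound \<open>G\<close> is established in the
  iteration whose root \<open>r\<close> lies in \<open>U\<close>, and it survives the later ones
  because records only improve.\<close>

lemma runs_safe_set_search:
  assumes T: "undirected_tree T" "pverts T = {..<n}" "edge_list T es"
    and U: "connected_safe_set (with_proj T) w U"
    and k: "2 + card {v \<in> U. \<delta> < w v} \<le> k"
  shows "runs (safe_set_search k) (input_memory n es w) (total_time n (length es) k)
    (\<lambda>M. connected_safe_set (with_proj T) w (output_set n M) \<and>
      weight w (output_set n M) \<le> weight w U + \<delta>)"
proof -
  let ?M = "input_memory n es w"
  let ?c = "Seq root_tree (nest k (try_tuple k))"
  define G where "G M \<longleftrightarrow> 0 < M 13 0 \<and> M 13 0 \<le> Suc (weight w U + \<delta>)" for M :: memory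
  have G_cong: "G M'" if "G M" "M' 13 = M 13" for M M' using that by (simp add: G_def)
  have "U \<subseteq> {..<n}" "U \<noteq> {}"
    using U T(2) by (auto simp: connected_safe_set_def safe_set_def connected_conv)
  then obtain r where r: "r \<in> U" "r < n" by auto
  have M: "stores_graph n es w ?M" by (simp add: stores_graph_def input_memory_def)
  have wr: "writes ?c \<subseteq> {4, 5, 6, 7, 8, 9, 10, 11, 12, 13, 15, 16, 17}"
    using writes_nest[of k "try_tuple k"] by (auto simp: writes_root_tree writes_try_tuple)
  have graph: "stores_graph n es w N" if "same_outside (insert 14 (writes ?c)) ?M N" for N
  proof (rule stores_graph_cong[OF M])
    have "a \<notin> insert 14 (writes ?c)" if "a < 4" for a using wr that by auto
    then show "N 0 = ?M 0" "N 1 = ?M 1" "N 2 = ?M 2" "N 3 = ?M 3" using that by simp_all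
  qed
  have "runs (safe_set_search k) ?M (7 + atime (reg 0) + n * (40 + n * (100 + length es * 132) +
      nest_time n (200 + k * 60 + n * 420) k + atime (reg 0) + 10))
    (\<lambda>M. valid_best T n w M \<and> (r < n \<longrightarrow> G M))"
    unfolding safe_set_search_def
  proof (rule runs_For[where I = "\<lambda>i M. valid_best T n w M \<and> (r < i \<longrightarrow> G M)"])
    show "valid_best T n w (?M(14 := (?M 14)(0 := 0))) \<and> (r < 0 \<longrightarrow> G (?M(14 := (?M 14)(0 := 0))))"
      by (simp add: valid_best_def input_memory_def)
    show "aval (reg 0) N = n" if "same_outside (insert 14 (writes ?c)) ?M N" for N
      using graph[OF that] by (simp add: stores_graph_def)
    fix i N assume *: "i < n" "valid_best T n w N \<and> (r < i \<longrightarrow> G N)" "N 14 0 = i"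
      and fr: "same_outside (insert 14 (writes ?c)) ?M N"
    have N: "stores_graph n es w N" by (rule graph[OF fr])
    show "runs ?c N (40 + n * (100 + length es * 132) + nest_time n (200 + k * 60 + n * 420) k)
      (\<lambda>N'. N' 14 0 = i \<and> valid_best T n w (N'(14 := (N' 14)(0 := Suc i))) \<and>
        (r < Suc i \<longrightarrow> G (N'(14 := (N' 14)(0 := Suc i)))))"
    proof (rule runs_Seq[OF runs_root_tree[OF T N]])
      show "N 14 0 < n" using * by simp
      fix M1 assume 1: "rooted_tree T n (M1 7) (M1 8) \<and> M1 7 0 = N 14 0"
        "same_outside (writes root_tree) N M1"
      interpret rooted_tree T n "M1 7" "M1 8" w using 1(1) by simp
      have M1: "stores_graph n es w M1" "M1 4 = N 4" "M1 13 = N 13" "M1 14 = N 14"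
        using 1(2) N by (auto simp: writes_root_tree intro: stores_graph_cong)
      define I where "I M \<longleftrightarrow> env M \<and> valid_best T n w M \<and> M 14 = N 14" for M
      have "I M1" using M1 *(2)
        by (auto simp: I_def env_def stores_graph_def intro: valid_best_cong)
      have "G M1 \<longleftrightarrow> G N" using M1 by (simp add: G_def)
      \<comment> \<open>For other roots \<open>x\<close> and \<open>Z\<close> are arbitrary and the
        implication is void.\<close>
      obtain x Z where x: "i = r \<Longrightarrow> good k x Z \<delta> \<and> sum wt Z = weight w U \<and> (\<forall>j<k. x j < n)"
      proof (cases "i = r")
        case True
        then have "M1 7 0 \<in> U" using 1(1) * r by simp
        then show thesis using good_tuple_exists[OF U _ k] that by metis
      qed (use that in blast)
      have "2 \<le> k" using k by simp
      have "runs (nest k (try_tuple k)) M1 (nest_time n (200 + k * 60 + n * 420) k)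
        (\<lambda>M'. I M' \<and> (G M1 \<longrightarrow> G M') \<and> (i = r \<and> (\<forall>j. k \<le> j \<and> j < k \<longrightarrow> M1 5 j = x j) \<longrightarrow> G M') \<and>
          (\<forall>j\<ge>k. M' 5 j = M1 5 j))"
      proof (rule runs_nest[where k = k])
        show "M 0 0 = n" if "I M" for M using that by (simp add: I_def env_def)
        show "0 \<notin> writes (try_tuple k)" "5 \<notin> writes (try_tuple k)" by (auto simp: writes_try_tuple)
        show "I (M(5 := f))" if "I M" for M f
          using that by (auto simp: I_def intro: env_cong valid_best_cong)
        show "G (M(5 := f))" if "G M" for M f using that by (auto intro: G_cong)
        fix M assume IM: "I M" and x_less: "\<forall>j<k. M 5 j < n"
        have "runs (try_tuple k) M (200 + k * 60 + n * 420) (\<lambda>M'.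
          ((M' 4 = M 4 \<and> M' 13 = M 13) \<or> (connected_safe_set (with_proj T) w (output_set n M') \<and>
            M' 13 0 = Suc (weight w (output_set n M')) \<and> (0 < M 13 0 \<longrightarrow> M' 13 0 \<le> M 13 0))) \<and>
          (\<forall>Z \<delta>. good k (M 5) Z \<delta> \<longrightarrow> 0 < M' 13 0 \<and> M' 13 0 \<le> Suc (sum wt Z + \<delta>)))"
          using IM x_less \<open>2 \<le> k\<close> by (intro runs_try_tuple) (auto simp: I_def)
        then show "runs (try_tuple k) M (200 + k * 60 + n * 420)
          (\<lambda>M'. I M' \<and> (G M \<longrightarrow> G M') \<and> (i = r \<and> (\<forall>j<k. M 5 j = x j) \<longrightarrow> G M'))"
        proof (rule runs_weaken)
          fix M' assume M': "((M' 4 = M 4 \<and> M' 13 = M 13) \<or> (connected_safe_set (with_proj T) w (output_set n M') \<and>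
            M' 13 0 = Suc (weight w (output_set n M')) \<and> (0 < M 13 0 \<longrightarrow> M' 13 0 \<le> M 13 0))) \<and>
          (\<forall>Z \<delta>. good k (M 5) Z \<delta> \<longrightarrow> 0 < M' 13 0 \<and> M' 13 0 \<le> Suc (sum wt Z + \<delta>))"
            and fr': "same_outside (writes (try_tuple k)) M M'"
          have "env M'" by (rule env_cong[of M]) (use IM fr' in \<open>auto simp: I_def writes_try_tuple\<close>)
          moreover have "M' 14 = N 14" using IM fr' by (simp add: I_def writes_try_tuple)
          moreover have "valid_best T n w M'"
            using M' IM valid_best_cong[of T n w M M'] by (auto simp: I_def valid_best_def)
          moreover have "G M'" if "G M" using that M' by (auto simp: G_def)
          moreover have "G M'" if "i = r" "\<forall>j<k. M 5 j = x j"
          proof -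
            have "M 5 ` {1..<k} = x ` {1..<k}" using that(2) by (intro image_cong) auto
            then have "good k (M 5) Z \<delta>"
              using x[OF that(1)] that(2) \<open>2 \<le> k\<close> by (simp add: good_def)
            then have "0 < M' 13 0 \<and> M' 13 0 \<le> Suc (sum wt Z + \<delta>)" using M' by blast
            then show ?thesis using x[OF that(1)] by (simp add: G_def)
          qed
          ultimately show "I M' \<and> (G M \<longrightarrow> G M') \<and> (i = r \<and> (\<forall>j<k. M 5 j = x j) \<longrightarrow> G M')"
            by (simp add: I_def)
        qed simp
      qed (use x \<open>I M1\<close> in auto)
      then show "runs (nest k (try_tuple k)) M1 (nest_time n (200 + k * 60 + n * 420) k)
        (\<lambda>N'. N' 14 0 = i \<and> valid_best T n w (N'(14 := (N' 14)(0 := Suc i))) \<and>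
        (r < Suc i \<longrightarrow> G (N'(14 := (N' 14)(0 := Suc i)))))"
      proof (rule runs_weaken)
        fix N' assume N': "I N' \<and> (G M1 \<longrightarrow> G N') \<and>
          (i = r \<and> (\<forall>j. k \<le> j \<and> j < k \<longrightarrow> M1 5 j = x j) \<longrightarrow> G N') \<and> (\<forall>j\<ge>k. N' 5 j = M1 5 j)"
        have "N' 14 0 = i" using N' * by (simp add: I_def)
        moreover have "valid_best T n w (N'(14 := f))" for f
          using N' by (auto simp: I_def intro: valid_best_cong)
        moreover have "G N'" if "r < Suc i"
          using that N' * \<open>G M1 \<longleftrightarrow> G N\<close> by (cases "i = r") auto
        then have "r < Suc i \<longrightarrow> G (N'(14 := f))" for f by (auto intro: G_cong)
        ultimately show "N' 14 0 = i \<and> valid_best T n w (N'(14 := (N' 14)(0 := Suc i))) \<and>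
          (r < Suc i \<longrightarrow> G (N'(14 := (N' 14)(0 := Suc i))))" by blast
      qed simp
    qed simp
  qed
  then show ?thesis
    by (rule runs_weaken) (use r in \<open>auto simp: total_time_def valid_best_def G_def\<close>)
qed

section \<open>The optimum, the number of heavy vertices and the total running time\<close>

lemma connected_safe_number_attained:
  assumes "undirected_tree T"
  obtains U where "connected_safe_set (with_proj T) w U" "weight w U = connected_safe_number (with_proj T) w"
proof -
  interpret pair_graph T using assms by (simp add: undirected_tree_def)
  let ?W = "{weight w S |S. connected_safe_set (with_proj T) w S}"
  have "finite ?W"
    by (rule finite_subset[of _ "weight w ` Pow (pverts T)"])
      (auto simp: connected_safe_set_def safe_set_def)
  \<comment> \<open>The whole vertex set is a connected safe set, as its complement has no
    components; so the minimum ranges over a nonempty set.\<close>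
  have "with_proj T \<restriction> pverts T = with_proj T"
    using wellformed' by (auto simp: induce_subgraph_def with_proj_def)
  moreover have "components (with_proj T \<restriction> {}) = {}"
    using component_induced_verts(1,2)[of "{}"] by blast
  ultimately have "connected_safe_set (with_proj T) w (pverts T)"
    using assms by (simp add: connected_safe_set_def safe_set_def undirected_tree_def)
  then have "?W \<noteq> {}" by blast
  then have "connected_safe_number (with_proj T) w \<in> ?W"
    unfolding connected_safe_number_def using Min_in \<open>finite ?W\<close> by blast
  then show thesis using that by auto
qed

text \<open>Weights are integers, so a heavy vertex weighs at least
  \<open>Suc ?\<delta> \<ge> \<epsilon> * ?W\<close>, while all heavy vertices together weigh at
  most \<open>?W\<close>.\<close>

lemma card_heavy_le:
  fixes \<epsilon> :: real
  assumes "0 < \<epsilon>" and "finite U"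
  shows "card {v \<in> U. nat \<lfloor>\<epsilon> * weight w U\<rfloor> < w v} \<le> nat \<lfloor>1 / \<epsilon>\<rfloor>"
proof -
  let ?W = "weight w U"
  let ?\<delta> = "nat \<lfloor>\<epsilon> * ?W\<rfloor>"
  let ?H = "{v \<in> U. ?\<delta> < w v}"
  have "card ?H * Suc ?\<delta> \<le> sum w ?H"
    using sum_bounded_below[of ?H "Suc ?\<delta>" w] by auto
  also have "\<dots> \<le> ?W" unfolding weight_def using assms(2) by (intro sum_mono2) auto
  finally have le: "card ?H * Suc ?\<delta> \<le> ?W" .
  show ?thesis
  proof (cases "?W = 0")
    \<comment> \<open>Division by \<open>?W\<close> is impossible here, but the positive factor
      \<open>Suc ?\<delta>\<close> forces the count to be 0.\<close>
    case True
    then show ?thesis using le by simp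
  next
    case False
    have "\<epsilon> * ?W \<le> real (Suc ?\<delta>)" using assms(1) by linarith
    then have "real (card ?H) * (\<epsilon> * ?W) \<le> real (card ?H) * real (Suc ?\<delta>)"
      by (intro mult_left_mono) auto
    also have "\<dots> \<le> real ?W" using le by (metis of_nat_le_iff of_nat_mult)
    finally have "real (card ?H) * \<epsilon> \<le> 1" using False by (simp add: field_simps)
    then have "real (card ?H) \<le> 1 / \<epsilon>" using assms(1) by (simp add: field_simps)
    then show ?thesis by (simp add: le_nat_floor)
  qed
qed

text \<open>A quadratic bound is good enough: rooting the tree at every vertex then costs of the
  order \<open>n ^ 4\<close>, which \<open>n ^ (k + 2)\<close> dominates for
  \<open>k \<ge> 2\<close>.\<close>

lemma length_edge_list_le:
  assumes "pair_graph T" "pverts T = {..<n}" "edge_list T es"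
  shows "length es \<le> n * n"
proof -
  interpret pair_graph T by (rule assms(1))
  have "set es \<subseteq> {..<n} \<times> {..<n}"
    using assms(2,3) wellformed' unfolding edge_list_def by fastforce
  then have "card (set es) \<le> card ({..<n} \<times> {..<n})" by (intro card_mono) auto
  then show ?thesis using assms(3) distinct_card by (fastforce simp: edge_list_def)
qed

lemma total_time_le:
  assumes "0 < n" and "m \<le> n * n" and "2 \<le> k"
  shows "total_time n m k \<le> 1000 * k * n ^ (k + 2)"
proof -
  have pow: "n ^ i \<le> n ^ (k + 2)" if "i \<le> k + 2" for i
    using that assms(1) by (intro power_increasing) auto
  have "nest_time n (200 + k * 60 + n * 420) k \<le> n ^ k * (200 + k * 60 + n * 420 + 21 * k)"
    by (rule nest_time_le[OF assms(1)])
  also have "\<dots> \<le> n ^ k * (200 * n + k * 60 * n + n * 420 + 21 * k * n)"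
    using assms(1) by (intro mult_left_mono add_mono) auto
  also have "\<dots> = n ^ (k + 1) * (620 + 81 * k)" by (simp add: algebra_simps)
  finally have "n * nest_time n (200 + k * 60 + n * 420) k \<le> n * (n ^ (k + 1) * (620 + 81 * k))"
    by (rule mult_le_mono2)
  then have nest: "n * nest_time n (200 + k * 60 + n * 420) k \<le> n ^ (k + 2) * (620 + 81 * k)"
    by (simp add: mult.assoc)
  have "total_time n m k = 9 + n * 52 + 100 * (n * n) + n * n * m * 132 +
      n * nest_time n (200 + k * 60 + n * 420) k"
    by (simp add: total_time_def algebra_simps)
  also have "\<dots> \<le> 9 + n * 52 + 100 * (n * n) + n * n * (n * n) * 132 + n ^ (k + 2) * (620 + 81 * k)"
    by (rule add_mono[OF _ nest]) (use assms(2) in simp)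
  also have "\<dots> \<le> 9 * n ^ (k + 2) + 52 * n ^ (k + 2) + 100 * n ^ (k + 2) + 132 * n ^ (k + 2) +
      n ^ (k + 2) * (620 + 81 * k)"
    using pow[of 0] pow[of 1] pow[of 2] pow[of 4] assms(3)
    by (intro add_mono) (auto simp: power2_eq_square power4_eq_xxxx algebra_simps)
  \<comment> \<open>The constant is 9 + 52 + 100 + 132 + 620, where 620 is 200 + 420 from the cost
    of a trial; 81 is 60 + 21, from marking the tuple and from the loop overhead.\<close>
  also have "\<dots> = (913 + 81 * k) * n ^ (k + 2)" by (simp add: algebra_simps)
  also have "\<dots> \<le> 1000 * k * n ^ (k + 2)" using assms(3) by (intro mult_right_mono) auto
  finally show ?thesis .
qed

theorem theorem1:
  shows "\<exists>K L :: real. 0 < K \<and> 0 < L \<and>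
    (\<forall>\<epsilon> :: real. 0 < \<epsilon> \<longrightarrow>
      (\<exists>A :: com. \<forall>(n :: nat) (T :: nat pair_pre_digraph) (w :: nat \<Rightarrow> nat) (es :: (nat \<times> nat) list).
        undirected_tree T \<and> pverts T = {..<n} \<and> edge_list T es \<longrightarrow>
        (\<exists>t M. exec A (input_memory n es w) t M \<and>
          connected_safe_set (with_proj T) w (output_set n M) \<and>
          real (weight w (output_set n M)) \<le> (1 + \<epsilon>) * real (connected_safe_number (with_proj T) w) \<and>
          real t \<le> K * (max 1 (1 / \<epsilon>)) ^ 4 * real n powr (L * max 1 (1 / \<epsilon>)))))"
\<comment> \<open>With \<open>E = max 1 (1 / \<epsilon>)\<close> the tuple length satisfies
  \<open>k \<le> 2 + E \<le> 3 * E\<close>. So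
  \<open>1000 * k \<le> 3000 * E \<le> 3000 * E ^ 4\<close>, and the exponent is
  \<open>k + 2 \<le> 4 + E \<le> 5 * E\<close>.\<close>
proof (rule exI[of _ 3000], rule exI[of _ 5], intro conjI allI impI)
  fix \<epsilon> :: real assume \<epsilon>: "0 < \<epsilon>"
  \<comment> \<open>Two entries for the threshold and the light bound, the others for the heavy
    vertices counted by \<open>card_heavy_le\<close>.\<close>
  define k where "k = 2 + nat \<lfloor>1 / \<epsilon>\<rfloor>"
  define E where "E = max 1 (1 / \<epsilon>)"
  have E: "1 \<le> E" "real k \<le> 2 + E" using \<epsilon> by (auto simp: E_def k_def) linarith+
  show "\<exists>A. \<forall>n T w es. undirected_tree T \<and> pverts T = {..<n} \<and> edge_list T es \<longrightarrow>
    (\<exists>t M. exec A (input_memory n es w) t M \<and>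
      connected_safe_set (with_proj T) w (output_set n M) \<and>
      real (weight w (output_set n M)) \<le> (1 + \<epsilon>) * real (connected_safe_number (with_proj T) w) \<and>
      real t \<le> 3000 * (max 1 (1 / \<epsilon>)) ^ 4 * real n powr (5 * max 1 (1 / \<epsilon>)))"
  proof (intro exI[of _ "safe_set_search k"] allI impI)
    fix n :: nat and T :: "nat pair_pre_digraph" and w :: "nat \<Rightarrow> nat" and es :: "(nat \<times> nat) list"
    assume "undirected_tree T \<and> pverts T = {..<n} \<and> edge_list T es"
    then have T: "undirected_tree T" "pverts T = {..<n}" "edge_list T es" by auto
    then have "0 < n" "pair_graph T" by (auto simp: undirected_tree_def connected_conv)
    obtain U where U: "connected_safe_set (with_proj T) w U"
      "weight w U = connected_safe_number (with_proj T) w"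
      using connected_safe_number_attained[OF T(1)] by blast
    have "finite U"
      by (rule finite_subset[of _ "{..<n}"]) (use U(1) T(2) in \<open>auto simp: connected_safe_set_def safe_set_def\<close>)
    let ?\<delta> = "nat \<lfloor>\<epsilon> * weight w U\<rfloor>"
    have "2 + card {v \<in> U. ?\<delta> < w v} \<le> k"
      using card_heavy_le[OF \<epsilon> \<open>finite U\<close>, of w] by (simp add: k_def)
    from runs_safe_set_search[OF T U(1) this] obtain t M where
      t: "exec (safe_set_search k) (input_memory n es w) t M" "t \<le> total_time n (length es) k"
      and M: "connected_safe_set (with_proj T) w (output_set n M)"
        "weight w (output_set n M) \<le> weight w U + ?\<delta>"
      unfolding runs_def by blast
    have "real ?\<delta> \<le> \<epsilon> * weight w U" using \<epsilon> by simp
    then have "real (weight w (output_set n M)) \<le> (1 + \<epsilon>) * real (weight w U)"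
      using M(2) by (simp add: algebra_simps)
    moreover have "real t \<le> 3000 * E ^ 4 * real n powr (5 * E)"
    proof -
      have "t \<le> 1000 * k * n ^ (k + 2)"
        using t(2) total_time_le[OF \<open>0 < n\<close> length_edge_list_le[OF \<open>pair_graph T\<close> T(2,3)], of k]
        by (simp add: k_def)
      then have "real t \<le> 1000 * real k * real n ^ (k + 2)"
        by (metis of_nat_le_iff of_nat_mult of_nat_numeral of_nat_power)
      also have "real n ^ (k + 2) = real n powr real (k + 2)"
        using \<open>0 < n\<close> by (intro powr_realpow[symmetric]) simp
      also have "1000 * real k * real n powr real (k + 2) \<le> 3000 * E ^ 4 * real n powr (5 * E)"
      proof (rule mult_mono)
        have "E ^ 1 \<le> E ^ 4" using E(1) by (intro power_increasing) auto
        then show "1000 * real k \<le> 3000 * E ^ 4" using E by simp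
        show "real n powr real (k + 2) \<le> real n powr (5 * E)"
          using \<open>0 < n\<close> E by (intro powr_mono) auto
      qed (use E in auto)
      finally show ?thesis .
    qed
    ultimately show "\<exists>t M. exec (safe_set_search k) (input_memory n es w) t M \<and>
      connected_safe_set (with_proj T) w (output_set n M) \<and>
      real (weight w (output_set n M)) \<le> (1 + \<epsilon>) * real (connected_safe_number (with_proj T) w) \<and>
      real t \<le> 3000 * (max 1 (1 / \<epsilon>)) ^ 4 * real n powr (5 * max 1 (1 / \<epsilon>))"
      using t(1) M(1) U(2) unfolding E_def by auto
  qed
qed auto

end
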